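(* Let $d:=p\cdot n$ satisfy $\log n\ll d\ll n$. Let $i=i(n)\in\mathbb{N}$ be the largest integer $i$ such that $d^i\ll n$. If $d^{i+1}/n-2\log n\to\infty$, then asymptotically almost surely $G\in\mathcal{G}(n,p)$ satisfies \[ \zeta(G)\le(1+o(1))\left(\log d+2\log\log n\right)\frac{n}{d^i}. \]
   Context: $\mathcal{G}(n,p)$ is the binomial random graph on vertex set $[n]$ where each pair is an edge independently with probability $p=p(n)$. A property holds asymptotically almost surely (a.a.s.) if its probability tends to $1$ as $n\to\infty$. Notation: $f\ll g$ means $f/g\to 0$; $\log$ is the natural logarithm. Localization game with $k$ sensors on a connected graph $G$: in round $1$ the cops choose a set $S_1\subseteq V(G)$ with $|S_1|=k$, then the (invisible) robber chooses a vertex $v_1$; in each round $t\ge 2$ the cops choose a new set $S_t$ of size $k$ (based on all previous information), then the robber moves to a vertex $v_t$ at distance at most $1$ from $v_{t-1}$. After each round the cops learn the vector of graph distances from the robber's current vertex to the vertices of $S_t$. The cops win in round $t$ if every two walks $(w_1,\dots,w_t)$, $(x_1,\dots,x_t)$ (consecutive vertices equal or adjacent) which produce the same sequence of distance vectors with respect to $(S_1,\dots,S_t)$ satisfy $w_t=x_t$. The localization number $\zeta(G)$ is the least $k$ such that the cops can win in finite time against every robber strategy. *)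

theory Defs
  imports "HOL-Probability.Product_PMF" "HOL-Library.Landau_Symbols"
    "Graph_Theory.Graph_Theory"
begin

section \<open>The binomial random graph\<close>

text \<open>Undirected simple graphs are symmetric loop-free digraphs (locale \<open>pair_graph\<close>).\<close>

definition vertex_pairs :: "nat \<Rightarrow> nat set set" where
  "vertex_pairs n = {e. e \<subseteq> {1..n} \<and> card e = 2}"

definition graph_of_choice :: "nat \<Rightarrow> (nat set \<Rightarrow> bool) \<Rightarrow> nat pair_pre_digraph" where
  "graph_of_choice n c =
     \<lparr> pverts = {1..n}, parcs = {(u, v). {u, v} \<in> vertex_pairs n \<and> c {u, v}} \<rparr>"

definition binomial_random_graph :: "nat \<Rightarrow> real \<Rightarrow> nat pair_pre_digraph pmf" where
  "binomial_random_graph n p =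
     map_pmf (graph_of_choice n) (Pi_pmf (vertex_pairs n) False (\<lambda>_. bernoulli_pmf p))"

definition aas :: "(nat \<Rightarrow> real) \<Rightarrow> (nat \<Rightarrow> nat pair_pre_digraph \<Rightarrow> bool) \<Rightarrow> bool" where
  "aas p P \<longleftrightarrow>
     (\<lambda>n. measure_pmf.prob (binomial_random_graph n (p n)) {G. P n G}) \<longlonglongrightarrow> 1"

lemma pair_graph_graph_of_choice: "pair_graph (graph_of_choice n c)"
proof
  show fin: "finite (pverts (graph_of_choice n c))"
    by (simp add: graph_of_choice_def)
  have "parcs (graph_of_choice n c) \<subseteq> {1..n} \<times> {1..n}"
    by (auto simp: graph_of_choice_def vertex_pairs_def)
  then show "finite (parcs (graph_of_choice n c))"
    by (rule finite_subset) simp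
  show "symmetric (with_proj (graph_of_choice n c))"
    by (auto simp: symmetric_def graph_of_choice_def sym_def insert_commute)
qed (auto simp: graph_of_choice_def vertex_pairs_def)

lemma pair_graph_binomial_random_graph:
  assumes "G \<in> set_pmf (binomial_random_graph n p)"
  shows "pair_graph G"
  using assms by (auto simp: binomial_random_graph_def pair_graph_graph_of_choice)


section \<open>The localization game\<close>

definition graph_dist :: "'a pair_pre_digraph \<Rightarrow> 'a \<Rightarrow> 'a \<Rightarrow> ereal" where
  "graph_dist G u v = wf_digraph.\<mu> (with_proj G) (\<lambda>_. 1) u v"

text \<open>The distance vector is indexed by the sensors, so its domain also records the sensor set.\<close>

definition dist_vector :: "'a pair_pre_digraph \<Rightarrow> 'a set \<Rightarrow> 'a \<Rightarrow> ('a \<rightharpoonup> ereal)" where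
  "dist_vector G S v = (\<lambda>s. if s \<in> S then Some (graph_dist G v s) else None)"

text \<open>
  Walks are functions of the round number; rounds are numbered from 1, and the value at 0 is
  irrelevant. The robber may stay where he is.
\<close>

definition robber_walk :: "'a pair_pre_digraph \<Rightarrow> nat \<Rightarrow> (nat \<Rightarrow> 'a) \<Rightarrow> bool" where
  "robber_walk G t w \<longleftrightarrow>
     (\<forall>s\<in>{1..t}. w s \<in> pverts G) \<and>
     (\<forall>s\<in>{1..<t}. w (Suc s) = w s \<or> w s \<rightarrow>\<^bsub>with_proj G\<^esub> w (Suc s))"

text \<open>
  A cop strategy maps the list of distance vectors learned so far to the next sensor set.
  \<open>observed G \<sigma> v t\<close> is the list of vectors learned in rounds 1 to \<open>t\<close>, and
  \<open>sensors G \<sigma> v t\<close> is the set \<open>S\<^sub>t\<close>, when the cops play \<open>\<sigma>\<close> and the robber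
  is at \<open>v s\<close> in round \<open>s\<close>.
\<close>

type_synonym 'a cop_strategy = "('a \<rightharpoonup> ereal) list \<Rightarrow> 'a set"

primrec observed ::
  "'a pair_pre_digraph \<Rightarrow> 'a cop_strategy \<Rightarrow> (nat \<Rightarrow> 'a) \<Rightarrow> nat \<Rightarrow> ('a \<rightharpoonup> ereal) list" where
  "observed G \<sigma> v 0 = []"
| "observed G \<sigma> v (Suc t) =
     observed G \<sigma> v t @ [dist_vector G (\<sigma> (observed G \<sigma> v t)) (v (Suc t))]"

definition sensors ::
  "'a pair_pre_digraph \<Rightarrow> 'a cop_strategy \<Rightarrow> (nat \<Rightarrow> 'a) \<Rightarrow> nat \<Rightarrow> 'a set" where
  "sensors G \<sigma> v t = \<sigma> (observed G \<sigma> v (t - 1))"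

text \<open>
  The sensor sets depend on the distance vectors the cops have actually learned, so the pairs of
  walks to be compared are those producing that learned sequence.
\<close>

definition consistent_walk ::
  "'a pair_pre_digraph \<Rightarrow> 'a cop_strategy \<Rightarrow> (nat \<Rightarrow> 'a) \<Rightarrow> nat \<Rightarrow> (nat \<Rightarrow> 'a) \<Rightarrow> bool" where
  "consistent_walk G \<sigma> v t w \<longleftrightarrow>
     robber_walk G t w \<and>
     (\<forall>s\<in>{1..t}. dist_vector G (sensors G \<sigma> v s) (w s) = dist_vector G (sensors G \<sigma> v s) (v s))"

definition cops_win_in_round ::
  "'a pair_pre_digraph \<Rightarrow> 'a cop_strategy \<Rightarrow> (nat \<Rightarrow> 'a) \<Rightarrow> nat \<Rightarrow> bool" where
  "cops_win_in_round G \<sigma> v t \<longleftrightarrow>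
     (\<forall>w x. consistent_walk G \<sigma> v t w \<and> consistent_walk G \<sigma> v t x \<longrightarrow> w t = x t)"

text \<open>
  Cop strategies are deterministic, so the outcomes of all robber strategies, even of those that
  react to the sensor sets, are exactly the infinite walks \<open>v\<close>.
\<close>

definition cops_can_win :: "'a pair_pre_digraph \<Rightarrow> nat \<Rightarrow> bool" where
  "cops_can_win G k \<longleftrightarrow>
     (\<exists>\<sigma>. (\<forall>h. \<sigma> h \<subseteq> pverts G \<and> card (\<sigma> h) = k) \<and>
          (\<forall>v. (\<forall>t. robber_walk G t v) \<longrightarrow> (\<exists>t\<ge>1. cops_win_in_round G \<sigma> v t)))"

text \<open>Only meaningful for finite connected graphs; \<open>k = card (pverts G)\<close> always suffices there.\<close>

definition localization_number :: "'a pair_pre_digraph \<Rightarrow> nat" where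
  "localization_number G = (LEAST k. cops_can_win G k)"

end

theory Submission
  imports Defs "HOL-Real_Asymp.Real_Asymp"
begin

text \<open>
  If every two vertices are told apart by at least \<open>2 (1 - \<delta>) d^i\<close> vertices, then a greedily
  chosen set of \<open>K n / d^i\<close> sensors leaves at most a fraction \<open>exp (- 2 (1 - \<delta>) K)\<close> of the pairs
  from a set of candidates indistinguishable. For \<open>K\<close> slightly above \<open>ln d\<close> this fraction beats
  the square of the factor, at most \<open>3 d\<close>, by which the candidate set can grow when the robber moves,
  so the candidate set shrinks strictly in every round.

  Balls of radius \<open>i\<close> around one vertex have size about \<open>d^i\<close> and around two vertices
  about \<open>2 d^i\<close>; inclusion-exclusion then shows that two such balls are almost disjoint, and every
  vertex of their symmetric difference tells the centres apart. The sizes are controlled by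
  breadth-first exploration: given the explored part, the next sphere depends only on fresh edges
  and its size is concentrated. As the relative errors at successive radii are dominated by
  geometric series, they stay summable even when \<open>i\<close> tends to infinity.
\<close>

section \<open>The game on graphs whose vertex pairs have many resolving vertices\<close>

text \<open>Where the robber can be after one move from a position in \<open>A\<close>; the same map
  drives breadth-first search.\<close>

definition closed_nbhd :: "'a pair_pre_digraph \<Rightarrow> 'a set \<Rightarrow> 'a set" where
  "closed_nbhd G A = {w \<in> pverts G. w \<in> A \<or> (\<exists>x\<in>A. (x, w) \<in> parcs G)}"

lemma closed_nbhd_subset: "closed_nbhd G A \<subseteq> pverts G"
  by (auto simp: closed_nbhd_def)

lemma card_closed_nbhd_le:
  assumes "finite (pverts G)" "A \<subseteq> pverts G"
    and "\<And>v. v \<in> pverts G \<Longrightarrow> real (card (closed_nbhd G {v})) \<le> c"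
  shows "real (card (closed_nbhd G A)) \<le> c * real (card A)"
proof -
  have fA: "finite A" using assms finite_subset by blast
  have "closed_nbhd G A = (\<Union>v\<in>A. closed_nbhd G {v})"
    by (auto simp: closed_nbhd_def)
  then have "card (closed_nbhd G A) \<le> (\<Sum>v\<in>A. card (closed_nbhd G {v}))"
    using card_UN_le[OF fA] by metis
  then have "real (card (closed_nbhd G A)) \<le> (\<Sum>v\<in>A. real (card (closed_nbhd G {v})))"
    by (metis of_nat_le_iff of_nat_sum)
  also have "\<dots> \<le> (\<Sum>v\<in>A. c)"
    by (intro sum_mono assms) (use assms(2) in blast)
  finally show ?thesis by (simp add: mult.commute)
qed

text \<open>Double counting: averaged over \<open>s \<in> V\<close>, at most a fraction
  \<open>1 - D / card V\<close> of the remaining elements is missed by \<open>s\<close>, so some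
  \<open>s\<close> does at least that well. Repeat \<open>k\<close> times; the same \<open>s\<close>
  may recur, whence \<open>card S \<le> k\<close>.\<close>

lemma greedy_hitting_set:
  fixes R :: "'p \<Rightarrow> 's \<Rightarrow> bool" and D :: real
  assumes "finite P" "finite V" "V \<noteq> {}" "D \<le> real (card V)"
    and deg: "\<And>p. p \<in> P \<Longrightarrow> D \<le> real (card {s \<in> V. R p s})"
  shows "\<exists>S\<subseteq>V. card S \<le> k \<and>
    real (card {p \<in> P. \<forall>s\<in>S. \<not> R p s}) \<le> real (card P) * (1 - D / real (card V)) ^ k"
proof (induction k)
  case 0
  show ?case by (rule exI[of _ "{}"]) simp
next
  case (Suc k)
  then obtain S where S: "S \<subseteq> V" "card S \<le> k"
    "real (card {p \<in> P. \<forall>s\<in>S. \<not> R p s}) \<le> real (card P) * (1 - D / real (card V)) ^ k"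
    by blast
  define Q where "Q = {p \<in> P. \<forall>s\<in>S. \<not> R p s}"
  have fQ: "finite Q" using assms(1) by (simp add: Q_def)
  have cV: "real (card V) > 0" using assms by (simp add: card_gt_0_iff)
  have "(\<Sum>s\<in>V. card {p\<in>Q. \<not> R p s}) = (\<Sum>p\<in>Q. card {s\<in>V. \<not> R p s})"
    using sum.swap_restrict[OF assms(2) fQ, of "\<lambda>_ _. 1::nat" "\<lambda>s p. \<not> R p s"] by simp
  then have "(\<Sum>s\<in>V. real (card {p\<in>Q. \<not> R p s})) = (\<Sum>p\<in>Q. real (card {s\<in>V. \<not> R p s}))"
    by (simp only: of_nat_sum[symmetric])
  also have "\<dots> \<le> (\<Sum>p\<in>Q. real (card V) - D)"
  proof (rule sum_mono)
    fix p assume "p \<in> Q"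
    then have "D \<le> real (card {s\<in>V. R p s})" using deg by (simp add: Q_def)
    moreover have "card {s\<in>V. R p s} + card {s\<in>V. \<not> R p s} = card V"
      using assms(2) by (subst card_Un_disjoint[symmetric]) (auto intro: arg_cong[where f=card])
    ultimately show "real (card {s\<in>V. \<not> R p s}) \<le> real (card V) - D" by linarith
  qed
  also have "\<dots> = (\<Sum>s\<in>V. real (card Q) * (1 - D / real (card V)))"
    using cV by (simp add: field_simps)
  finally have "(\<Sum>s\<in>V. real (card {p\<in>Q. \<not> R p s})) \<le>
    (\<Sum>s\<in>V. real (card Q) * (1 - D / real (card V)))" .
  \<comment> \<open>If every term exceeded the average, the sums would compare strictly the other
    way.\<close>
  then obtain s where s: "s \<in> V"
    "real (card {p\<in>Q. \<not> R p s}) \<le> real (card Q) * (1 - D / real (card V))"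
    using sum_strict_mono[OF assms(2,3)] by (meson linorder_not_le)
  have "{p \<in> P. \<forall>s\<in>insert s S. \<not> R p s} = {p\<in>Q. \<not> R p s}"
    by (auto simp: Q_def)
  moreover have "real (card Q) * (1 - D / real (card V))
      \<le> real (card P) * (1 - D / real (card V)) ^ k * (1 - D / real (card V))"
    using S(3) cV assms(4) by (intro mult_right_mono) (auto simp: Q_def)
  moreover have "card (insert s S) \<le> Suc k"
    using S(1,2) finite_subset[OF S(1) assms(2)] by (simp add: card_insert_if)
  ultimately show ?case
    using s S(1) by (intro exI[of _ "insert s S"]) (auto simp: mult_ac)
qed

text \<open>The closed neighbourhood of \<open>A\<close> spans at most \<open>(c * card A)^2\<close>
  ordered pairs, so by \<open>small\<close> the greedy sensors leave at most a quarter of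
  \<open>(card A)^2\<close> unresolved. A class of \<open>m\<close> indistinguishable candidates
  contributes \<open>m * (m - 1)\<close> such pairs, too many if \<open>m \<ge> 2\<close> and
  \<open>m \<ge> card A\<close>.\<close>

lemma exists_shrinking_sensors:
  fixes c D :: real
  assumes V: "finite (pverts G)" "pverts G \<noteq> {}" "k \<le> card (pverts G)" "D \<le> real (card (pverts G))"
    and deg: "\<And>v. v \<in> pverts G \<Longrightarrow> real (card (closed_nbhd G {v})) \<le> c"
    and sep: "\<And>u v. u \<in> pverts G \<Longrightarrow> v \<in> pverts G \<Longrightarrow> u \<noteq> v \<Longrightarrow>
      D \<le> real (card {s \<in> pverts G. graph_dist G u s \<noteq> graph_dist G v s})"
    and small: "4 * c\<^sup>2 * (1 - D / real (card (pverts G))) ^ k \<le> 1"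
    and A: "A \<subseteq> pverts G"
  shows "\<exists>S\<subseteq>pverts G. card S = k \<and>
    (\<forall>a. card {w \<in> closed_nbhd G A. dist_vector G S w = a} \<le> max 1 (card A - 1))"
proof -
  let ?V = "pverts G" and ?B = "closed_nbhd G A"
  define P where "P = {(u, v). u \<in> ?B \<and> v \<in> ?B \<and> u \<noteq> v}"
  define q where "q = (1 - D / real (card ?V)) ^ k"
  have "D / real (card ?V) \<le> 1" using V by (simp add: card_gt_0_iff)
  then have q0: "q \<ge> 0" by (simp add: q_def)
  have fB: "finite ?B" by (rule finite_subset[OF closed_nbhd_subset V(1)])
  have PB: "P \<subseteq> ?B \<times> ?B" by (auto simp: P_def)
  then have fP: "finite P" by (rule finite_subset) (simp add: fB)
  obtain S0 where S0: "S0 \<subseteq> ?V" "card S0 \<le> k"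
    "real (card {p \<in> P. \<forall>s\<in>S0. \<not> graph_dist G (fst p) s \<noteq> graph_dist G (snd p) s}) \<le> real (card P) * q"
  proof -
    have "D \<le> real (card {s \<in> ?V. graph_dist G (fst x) s \<noteq> graph_dist G (snd x) s})" if "x \<in> P" for x
      by (rule sep) (use that closed_nbhd_subset[of G A] in \<open>auto simp: P_def\<close>)
    from greedy_hitting_set[where k = k and R = "\<lambda>p s. graph_dist G (fst p) s \<noteq> graph_dist G (snd p) s",
        OF fP V(1,2,4) this] obtain S0 where "S0 \<subseteq> ?V" "card S0 \<le> k"
      "real (card {p \<in> P. \<forall>s\<in>S0. \<not> graph_dist G (fst p) s \<noteq> graph_dist G (snd p) s}) \<le> real (card P) * q"
      unfolding q_def by auto
    then show ?thesis by (rule that)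
  qed
  \<comment> \<open>Padding to exactly \<open>k\<close> sensors cannot merge classes.\<close>
  obtain S where S: "S0 \<subseteq> S" "S \<subseteq> ?V" "card S = k"
    using exists_subset_between[OF S0(2) V(3) S0(1) V(1)] by blast
  define bad where "bad = {p \<in> P. \<forall>s\<in>S0. \<not> graph_dist G (fst p) s \<noteq> graph_dist G (snd p) s}"
  have fbad: "finite bad" using fP by (simp add: bad_def)
  have "real (card P) \<le> (real (card ?B))\<^sup>2"
  proof -
    have "card P \<le> card (?B \<times> ?B)" using PB fB by (intro card_mono) auto
    then have "real (card P) \<le> real (card ?B * card ?B)" by (simp only: card_cartesian_product of_nat_le_iff)
    then show ?thesis by (simp add: power2_eq_square)
  qed
  also have "\<dots> \<le> (c * real (card A))\<^sup>2"
    using card_closed_nbhd_le[OF V(1) A deg] by (intro power_mono) auto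
  finally have "real (card P) * q \<le> (c * real (card A))\<^sup>2 * q"
    using q0 by (intro mult_right_mono)
  then have "4 * real (card bad) \<le> (real (card A))\<^sup>2 * (4 * c\<^sup>2 * q)"
    using S0(3) by (simp add: bad_def power_mult_distrib mult_ac)
  also have "\<dots> \<le> (real (card A))\<^sup>2 * 1"
    using small by (intro mult_left_mono) (auto simp: q_def)
  finally have "real (4 * card bad) \<le> real ((card A)\<^sup>2)" by simp
  then have cbad: "4 * card bad \<le> (card A)\<^sup>2" by (simp only: of_nat_le_iff)
  have "card {w \<in> ?B. dist_vector G S w = a} \<le> max 1 (card A - 1)" for a
  proof -
    define C where "C = {w \<in> ?B. dist_vector G S w = a}"
    have fC: "finite C" using fB by (simp add: C_def)
    have "C \<times> C - (\<lambda>x. (x, x)) ` C \<subseteq> bad"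
    proof safe
      fix x y assume xy: "x \<in> C" "y \<in> C" "(x, y) \<notin> (\<lambda>x. (x, x)) ` C"
      then have "x \<noteq> y" by auto
      moreover have "graph_dist G x s = graph_dist G y s" if "s \<in> S0" for s
      proof -
        have "dist_vector G S x s = dist_vector G S y s" using xy by (simp add: C_def)
        then show ?thesis using that S by (auto simp: dist_vector_def)
      qed
      ultimately show "(x, y) \<in> bad" using xy by (simp add: bad_def P_def C_def)
    qed
    then have "card (C \<times> C - (\<lambda>x. (x, x)) ` C) \<le> card bad"
      by (rule card_mono[OF fbad])
    moreover have "card (C \<times> C - (\<lambda>x. (x, x)) ` C) = card C * card C - card C"
      using fC by (subst card_Diff_subset) (auto simp: card_image inj_on_def card_cartesian_product)
    ultimately have "4 * (card C * card C - card C) \<le> (card A)\<^sup>2"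
      using cbad by linarith
    then have *: "4 * (card C * (card C - 1)) \<le> (card A)\<^sup>2"
      by (simp add: diff_mult_distrib2)
    have "card C \<le> max 1 (card A - 1)"
    proof (rule ccontr)
      assume "\<not> ?thesis"
      then have c: "card C \<ge> 2" "card C \<ge> card A" by auto
      then obtain m where m: "card C = m + 2" by (metis add.commute le_Suc_ex)
      have "(card A)\<^sup>2 \<le> (m + 2)\<^sup>2" using c m by (intro power_mono) auto
      \<comment> \<open>Cancelling \<open>m + 2\<close> leaves the impossible
        \<open>4 * (m + 1) \<le> m + 2\<close>.\<close>
      with * m have "4 * ((m + 2) * (m + 1)) \<le> (m + 2)\<^sup>2" 
      proof -
        have "card C - 1 = m + 1" using m by simp
        then show ?thesis using * m \<open>(card A)\<^sup>2 \<le> (m + 2)\<^sup>2\<close> by (metis order_trans)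
      qed
      then show False by (simp add: power2_eq_square algebra_simps)
    qed
    then show ?thesis by (simp add: C_def)
  qed
  then show ?thesis using S by (intro exI[of _ S]) simp
qed

lemma foldl_observed_Suc:
  "foldl f a (observed G \<sigma> v (Suc t)) =
     f (foldl f a (observed G \<sigma> v t)) (dist_vector G (\<sigma> (observed G \<sigma> v t)) (v (Suc t)))"
  by simp

text \<open>The cops replay the history to maintain the set of positions compatible with it and use
  the shrinking sensors for that set. It loses a vertex in every round until at most one candidate
  is left.\<close>

lemma cops_can_win_if_resolving:
  fixes c D :: real
  assumes V: "finite (pverts G)" "pverts G \<noteq> {}" "k \<le> card (pverts G)" "D \<le> real (card (pverts G))"
    and deg: "\<And>v. v \<in> pverts G \<Longrightarrow> real (card (closed_nbhd G {v})) \<le> c"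
    and sep: "\<And>u v. u \<in> pverts G \<Longrightarrow> v \<in> pverts G \<Longrightarrow> u \<noteq> v \<Longrightarrow>
      D \<le> real (card {s \<in> pverts G. graph_dist G u s \<noteq> graph_dist G v s})"
    and small: "4 * c\<^sup>2 * (1 - D / real (card (pverts G))) ^ k \<le> 1"
  shows "cops_can_win G k"
proof -
  let ?V = "pverts G"
  \<comment> \<open>The choice is made total: for \<open>A\<close> not inside the vertex set any
    \<open>k\<close> vertices do, so \<open>pick\<close> has size \<open>k\<close> without a side
    condition.\<close>
  have "\<forall>A. \<exists>S. S \<subseteq> ?V \<and> card S = k \<and> (A \<subseteq> ?V \<longrightarrow>
      (\<forall>a. card {w \<in> closed_nbhd G A. dist_vector G S w = a} \<le> max 1 (card A - 1)))"
  proof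
    fix A
    show "\<exists>S. S \<subseteq> ?V \<and> card S = k \<and> (A \<subseteq> ?V \<longrightarrow>
      (\<forall>a. card {w \<in> closed_nbhd G A. dist_vector G S w = a} \<le> max 1 (card A - 1)))"
    proof (cases "A \<subseteq> ?V")
      case True
      then show ?thesis using exists_shrinking_sensors[OF V deg sep small] by blast
    next
      case False
      then show ?thesis using obtain_subset_with_card_n[OF V(3)] by blast
    qed
  qed
  then obtain pick where pick: "\<And>A. pick A \<subseteq> ?V" "\<And>A. card (pick A) = k"
    "\<And>A a. A \<subseteq> ?V \<Longrightarrow> card {w \<in> closed_nbhd G A. dist_vector G (pick A) w = a} \<le> max 1 (card A - 1)"
    by metis
  define step where "step = (\<lambda>A a. {w \<in> closed_nbhd G A. dist_vector G (pick A) w = a})"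
  define cand where "cand = foldl step ?V"
  define \<sigma> where "\<sigma> = (\<lambda>h. pick (cand h))"
  have "\<exists>t\<ge>1. cops_win_in_round G \<sigma> v t" if v: "\<And>t. robber_walk G t v" for v
  proof -
    define C where "C = (\<lambda>t. cand (observed G \<sigma> v t))"
    have C0: "C 0 = ?V" by (simp add: C_def cand_def)
    have CS: "C (Suc t) = {w \<in> closed_nbhd G (C t).
        dist_vector G (pick (C t)) w = dist_vector G (pick (C t)) (v (Suc t))}" for t
      unfolding C_def cand_def foldl_observed_Suc by (simp add: step_def \<sigma>_def cand_def)
    have CV: "C t \<subseteq> ?V" for t
      by (cases t) (use closed_nbhd_subset[of G] C0 CS in auto)
    have sens: "sensors G \<sigma> v (Suc t) = pick (C t)" for t
      by (simp add: sensors_def \<sigma>_def C_def)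
    \<comment> \<open>Walks consistent with the learned vectors never leave the candidate sets, so
      they agree once at most one candidate remains.\<close>
    have mem: "s < t \<Longrightarrow> w (Suc s) \<in> C (Suc s)" if "consistent_walk G \<sigma> v t w" for t w s
    proof (induction s)
      case 0
      then have "w 1 \<in> ?V" using that by (auto simp: consistent_walk_def robber_walk_def)
      moreover have "dist_vector G (sensors G \<sigma> v (Suc 0)) (w (Suc 0)) =
          dist_vector G (sensors G \<sigma> v (Suc 0)) (v (Suc 0))"
        using that 0 by (auto simp: consistent_walk_def)
      ultimately show ?case by (simp add: CS C0 sens closed_nbhd_def)
    next
      case (Suc s)
      then have "w (Suc s) \<in> C (Suc s)" by simp
      moreover have "w (Suc (Suc s)) \<in> ?V"
        "w (Suc (Suc s)) = w (Suc s) \<or> (w (Suc s), w (Suc (Suc s))) \<in> parcs G"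
        using that Suc by (auto simp: consistent_walk_def robber_walk_def)
      ultimately have "w (Suc (Suc s)) \<in> closed_nbhd G (C (Suc s))"
        by (auto simp: closed_nbhd_def)
      moreover have "dist_vector G (sensors G \<sigma> v (Suc (Suc s))) (w (Suc (Suc s))) =
          dist_vector G (sensors G \<sigma> v (Suc (Suc s))) (v (Suc (Suc s)))"
        using that Suc.prems unfolding consistent_walk_def by (auto simp del: observed.simps)
      ultimately show ?case by (simp add: CS[of "Suc s"] sens)
    qed
    have card_C: "card (C t) \<le> max 1 (card ?V - t)" for t
    proof (induction t)
      case (Suc t)
      have "card (C (Suc t)) \<le> max 1 (card (C t) - 1)"
        unfolding CS by (rule pick(3)[OF CV])
      then show ?case using Suc by linarith
    qed (simp add: C0)
    \<comment> \<open>A successor, because \<open>mem\<close> speaks of rounds from 1 on; by then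
      the bound in \<open>card_C\<close> has dropped to 1.\<close>
    let ?t = "Suc (card ?V)"
    have "card (C ?t) \<le> Suc 0" using card_C[of ?t] by simp
    then have "\<forall>x\<in>C ?t. \<forall>y\<in>C ?t. x = y"
      using card_le_Suc0_iff_eq CV V(1) finite_subset by metis
    then have "cops_win_in_round G \<sigma> v ?t"
      using mem unfolding cops_win_in_round_def by blast
    then show ?thesis by (intro exI[of _ ?t]) simp
  qed
  then show ?thesis
    unfolding cops_can_win_def using pick by (intro exI[of _ \<sigma>]) (auto simp: \<sigma>_def)
qed

section \<open>Balls\<close>

lemma closed_nbhd_Un: "closed_nbhd G (A \<union> B) = closed_nbhd G A \<union> closed_nbhd G B"
  by (auto simp: closed_nbhd_def)

text \<open>Iterating the closed neighbourhood makes balls additive in the set of centres and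
  matches the step-by-step exploration below.\<close>

definition ball_of :: "'a pair_pre_digraph \<Rightarrow> nat \<Rightarrow> 'a set \<Rightarrow> 'a set" where
  "ball_of G j = (closed_nbhd G ^^ j)"

lemma ball_of_0 [simp]: "ball_of G 0 A = A"
  by (simp add: ball_of_def)

lemma ball_of_Suc: "ball_of G (Suc j) A = ball_of G j (closed_nbhd G A)"
  by (simp add: ball_of_def funpow_swap1)

lemma ball_of_Un: "ball_of G j (A \<union> B) = ball_of G j A \<union> ball_of G j B"
  by (induction j arbitrary: A B) (simp_all add: ball_of_Suc closed_nbhd_Un)

lemma ball_of_mono: "A \<subseteq> B \<Longrightarrow> ball_of G j A \<subseteq> ball_of G j B"
  by (metis ball_of_Un le_iff_sup)

lemma ball_of_subset: "A \<subseteq> pverts G \<Longrightarrow> ball_of G j A \<subseteq> pverts G"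
  by (induction j arbitrary: A) (simp_all add: ball_of_Suc closed_nbhd_subset)

lemma (in pair_wf_digraph) mem_ball_of_if_awalk:
  "awalk u q v \<Longrightarrow> length q \<le> j \<Longrightarrow> v \<in> ball_of G j {u}"
proof (induction q arbitrary: u j)
  case Nil
  then have "v = u" "u \<in> pverts G" by (auto simp: awalk_def)
  then show ?case
  proof (induction j)
    case (Suc j)
    then have "{u} \<subseteq> closed_nbhd G {u}" by (auto simp: closed_nbhd_def)
    then show ?case using Suc ball_of_mono[of "{u}" "closed_nbhd G {u}" G j] by (auto simp: ball_of_Suc)
  qed simp
next
  case (Cons e q)
  then obtain j' where j: "j = Suc j'" "length q \<le> j'" by (cases j) auto
  have e: "e \<in> parcs G" "fst e = u" "awalk (snd e) q v" using Cons.prems by (simp_all add: awalk_Cons_iff)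
  then have "v \<in> ball_of G j' {snd e}" using Cons.IH j by blast
  moreover have "{snd e} \<subseteq> closed_nbhd G {u}"
    using e arc_snd_in_verts by (auto simp: closed_nbhd_def)
  ultimately show ?case using ball_of_mono[of "{snd e}" "closed_nbhd G {u}" G j'] j
    by (auto simp: ball_of_Suc)
qed

lemma (in pair_wf_digraph) awalk_if_mem_ball_of:
  "A \<subseteq> pverts G \<Longrightarrow> v \<in> ball_of G j A \<Longrightarrow> \<exists>u\<in>A. \<exists>q. awalk u q v \<and> length q \<le> j"
proof (induction j arbitrary: A)
  case 0
  then show ?case by (intro bexI[of _ v] exI[of _ "[]"]) (auto simp: awalk_Nil_iff)
next
  case (Suc j)
  then have "v \<in> ball_of G j (closed_nbhd G A)" by (simp add: ball_of_Suc)
  then obtain u q where u: "u \<in> closed_nbhd G A" "awalk u q v" "length q \<le> j"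
    using Suc.IH closed_nbhd_subset by metis
  show ?case
  proof (cases "u \<in> A")
    case True
    then show ?thesis using u by (meson le_SucI)
  next
    case False
    then obtain x where x: "x \<in> A" "(x, u) \<in> parcs G" using u by (auto simp: closed_nbhd_def)
    then have "awalk x ((x, u) # q) v" using u Suc.prems by (auto simp: awalk_Cons_iff)
    then show ?thesis using x u by (metis Suc_le_mono length_Cons)
  qed
qed

text \<open>The distance is an infimum of walk lengths, infinite if no walk exists; balls collect
  the endpoints of short walks.\<close>

lemma (in pair_wf_digraph) graph_dist_le_iff:
  assumes "u \<in> pverts G"
  shows "graph_dist G u v \<le> ereal (real j) \<longleftrightarrow> v \<in> ball_of G j {u}"
proof
  assume "v \<in> ball_of G j {u}"
  then obtain q where q: "awalk u q v" "length q \<le> j"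
    using awalk_if_mem_ball_of[of "{u}"] assms by auto
  have "graph_dist G u v \<le> awalk_cost (\<lambda>_. 1) q"
    unfolding graph_dist_def by (rule min_cost_le_walk_cost[OF q(1)])
  also have "awalk_cost (\<lambda>_. 1) q = real (length q)"
    by (simp add: awalk_cost_def sum_list_triv)
  finally show "graph_dist G u v \<le> ereal (real j)" using q(2)
    by (meson dual_order.trans ereal_less_eq(3) of_nat_le_iff)
next
  assume le: "graph_dist G u v \<le> ereal (real j)"
  show "v \<in> ball_of G j {u}"
  proof (rule ccontr)
    assume nv: "v \<notin> ball_of G j {u}"
    \<comment> \<open>Integrality: a walk longer than \<open>j\<close> has length at least
      \<open>j + 1\<close>, a gap that survives the infimum.\<close>
    have "ereal (real (Suc j)) \<le> graph_dist G u v"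
      unfolding graph_dist_def \<mu>_def
    proof (rule INF_greatest)
      fix q assume "q \<in> {q. awalk u q v}"
      then have "\<not> length q \<le> j" using nv mem_ball_of_if_awalk by auto
      moreover have "awalk_cost (\<lambda>_. 1) q = real (length q)"
        by (simp add: awalk_cost_def sum_list_triv)
      ultimately show "ereal (real (Suc j)) \<le> ereal (awalk_cost (\<lambda>_. 1) q)" by simp
    qed
    then have "ereal (real (Suc j)) \<le> ereal (real j)" using le by (rule order_trans)
    then show False by simp
  qed
qed

text \<open>A vertex in exactly one of the two balls is within distance \<open>j\<close> of exactly
  one centre. The symmetric difference has twice the size of the union minus the sizes of both
  balls, so a large union and small balls give many resolving vertices.\<close>

lemma (in pair_wf_digraph) card_resolving_ge:
  assumes "finite (pverts G)" "u \<in> pverts G" "v \<in> pverts G"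
  shows "2 * card (ball_of G j {u, v}) \<le>
    card {s \<in> pverts G. graph_dist G u s \<noteq> graph_dist G v s} +
    card (ball_of G j {u}) + card (ball_of G j {v})"
proof -
  let ?R = "{s \<in> pverts G. graph_dist G u s \<noteq> graph_dist G v s}"
  let ?U = "ball_of G j {u}" and ?W = "ball_of G j {v}"
  have UW: "?U \<subseteq> pverts G" "?W \<subseteq> pverts G" using assms by (auto intro!: ball_of_subset)
  then have fin: "finite ?U" "finite ?W" using assms finite_subset by blast+
  have "(?U - ?W) \<union> (?W - ?U) \<subseteq> ?R"
  proof
    fix s assume s: "s \<in> (?U - ?W) \<union> (?W - ?U)"
    then have "(graph_dist G u s \<le> ereal (real j)) \<noteq> (graph_dist G v s \<le> ereal (real j))"
      unfolding graph_dist_le_iff[OF assms(2)] graph_dist_le_iff[OF assms(3)] by blast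
    then show "s \<in> ?R" using s UW by auto
  qed
  then have "card ((?U - ?W) \<union> (?W - ?U)) \<le> card ?R"
    using assms(1) by (intro card_mono) auto
  moreover have "card ((?U - ?W) \<union> (?W - ?U)) = card (?U - ?W) + card (?W - ?U)"
    using fin by (intro card_Un_disjoint) auto
  moreover have "ball_of G j {u, v} = ?U \<union> ?W"
    using ball_of_Un[of G j "{u}" "{v}"] by (simp add: insert_commute)
  then have "card (ball_of G j {u, v}) = card (?U \<union> (?W - ?U))"
    "card (ball_of G j {u, v}) = card (?W \<union> (?U - ?W))"
    by (simp_all add: Un_commute)
  then have "card (ball_of G j {u, v}) = card ?U + card (?W - ?U)"
    "card (ball_of G j {u, v}) = card ?W + card (?U - ?W)"
    using fin by (simp_all only: card_Un_disjoint Diff_disjoint finite_Diff)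
  ultimately show ?thesis by linarith
qed

section \<open>Exponential moments and tail bounds\<close>

text \<open>Two-stage experiment: \<open>T\<close> collects the bad outcomes of the first stage,
  where the conditional probability is bounded by 1.\<close>

lemma prob_bind_pmf_le:
  assumes "\<And>x. x \<in> set_pmf M \<Longrightarrow> x \<notin> T \<Longrightarrow> measure_pmf.prob (N x) S \<le> b" and "0 \<le> b"
  shows "measure_pmf.prob (bind_pmf M N) S \<le> measure_pmf.prob M T + b"
proof -
  have "emeasure (bind_pmf M N) S = (\<integral>\<^sup>+x. emeasure (N x) S \<partial>M)"
    by simp
  also have "\<dots> \<le> (\<integral>\<^sup>+x. indicator T x + ennreal b \<partial>M)"
  proof (intro nn_integral_mono_AE AE_pmfI)
    fix x assume x: "x \<in> set_pmf M"
    show "emeasure (N x) S \<le> indicator T x + ennreal b"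
    proof (cases "x \<in> T")
      case True
      have "emeasure (N x) S \<le> 1" by (rule measure_pmf.emeasure_le_1)
      then show ?thesis using True by (simp add: add_increasing2)
    next
      case False
      then show ?thesis using assms(1)[OF x]
        by (simp add: measure_pmf.emeasure_eq_measure ennreal_leI)
    qed
  qed
  also have "\<dots> = emeasure M T + ennreal b"
    by (subst nn_integral_add) simp_all
  also have "\<dots> = ennreal (measure_pmf.prob M T + b)"
    using assms(2) by (simp add: measure_pmf.emeasure_eq_measure)
  finally show ?thesis
    using assms(2) by (simp add: measure_pmf.emeasure_eq_measure del: ennreal_plus)
qed

text \<open>Markov's inequality for \<open>exp (l * Z x)\<close>. Keeping \<open>l\<close> on both
  sides of the event serves the upper tail with positive \<open>l\<close> and the lower tail with
  negative \<open>l\<close>.\<close>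

lemma prob_le_exp_moment:
  fixes Z :: "'a \<Rightarrow> real"
  assumes "(\<integral>\<^sup>+x. ennreal (exp (l * Z x)) \<partial>measure_pmf M) \<le> ennreal B" and "0 \<le> B"
  shows "measure_pmf.prob M {x. l * a \<le> l * Z x} \<le> exp (- (l * a)) * B"
proof -
  have "emeasure M {x. l * a \<le> l * Z x} = (\<integral>\<^sup>+x. indicator {x. l * a \<le> l * Z x} x \<partial>measure_pmf M)"
    by simp
  also have "\<dots> \<le> (\<integral>\<^sup>+x. ennreal (exp (- (l * a))) * ennreal (exp (l * Z x)) \<partial>measure_pmf M)"
    by (intro nn_integral_mono)
      (auto simp: indicator_def ennreal_mult[symmetric] exp_add[symmetric])
  also have "\<dots> = ennreal (exp (- (l * a))) * (\<integral>\<^sup>+x. ennreal (exp (l * Z x)) \<partial>measure_pmf M)"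
    by (rule nn_integral_cmult) simp
  also have "\<dots> \<le> ennreal (exp (- (l * a))) * ennreal B"
    by (intro mult_left_mono assms) simp
  also have "\<dots> = ennreal (exp (- (l * a)) * B)"
    using assms(2) by (simp add: ennreal_mult)
  finally show ?thesis
    using assms(2) by (simp add: measure_pmf.emeasure_eq_measure)
qed

text \<open>
  In both bounds the parameter \<open>l = \<plusminus>e / 2\<close> almost minimises the exponent.
\<close>

lemma poisson_upper_tail:
  fixes Z :: "'a \<Rightarrow> real"
  assumes mgf: "\<And>l. (\<integral>\<^sup>+x. ennreal (exp (l * Z x)) \<partial>measure_pmf M) \<le> ennreal (exp (\<mu> * (exp l - 1)))"
    and "\<mu> \<le> K" "0 < e" "e \<le> 2" "0 \<le> K"
  shows "measure_pmf.prob M {x. (1 + e) * K \<le> Z x} \<le> exp (- (K * e\<^sup>2 / 4))"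
proof -
  let ?l = "e / 2"
  have "{x. (1 + e) * K \<le> Z x} = {x. ?l * ((1 + e) * K) \<le> ?l * Z x}"
    using assms(3) by auto
  then have "measure_pmf.prob M {x. (1 + e) * K \<le> Z x}
      \<le> exp (- (?l * ((1 + e) * K))) * exp (\<mu> * (exp ?l - 1))"
    using prob_le_exp_moment[OF mgf, of ?l "(1 + e) * K"] by (simp only: exp_ge_zero)
  also have "\<dots> = exp (\<mu> * (exp ?l - 1) - ?l * ((1 + e) * K))"
    by (subst exp_add[symmetric]) (simp only: diff_conv_add_uminus add.commute)
  also have "\<dots> \<le> exp (- (K * e\<^sup>2 / 4))"
  proof -
    \<comment> \<open>Needs \<open>?l \<le> 1\<close>, hence \<open>e \<le> 2\<close>. With
      \<open>\<mu> \<le> K\<close> the exponent is at most \<open>K * (?l^2 - e * ?l)\<close>, which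
      equals \<open>- (K * e^2 / 4)\<close>.\<close>
    have "exp ?l \<le> 1 + ?l + ?l\<^sup>2" using assms by (intro exp_bound) auto
    moreover have "1 \<le> exp ?l" using assms by simp
    ultimately have "\<mu> * (exp ?l - 1) \<le> K * (?l + ?l\<^sup>2)"
      using assms by (intro order_trans[OF mult_right_mono[of \<mu> K] mult_left_mono]) auto
    then show ?thesis by (simp add: field_simps power2_eq_square)
  qed
  finally show ?thesis .
qed

text \<open>After multiplication by \<open>1 + x\<close> the left side is at most 1 and the right
  side is \<open>1 + x ^ 3\<close>.\<close>

lemma exp_minus_le:
  fixes x :: real
  assumes "0 \<le> x"
  shows "exp (- x) \<le> 1 - x + x\<^sup>2"
proof -
  have "exp (- x) * (1 + x) \<le> exp (- x) * exp x"
    by (intro mult_left_mono exp_ge_add_one_self) simp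
  also have "\<dots> = 1" by (simp add: exp_minus)
  also have "1 \<le> (1 - x + x\<^sup>2) * (1 + x)"
  proof -
    have "(1 - x + x\<^sup>2) * (1 + x) = 1 + x ^ 3" by (simp add: algebra_simps power2_eq_square power3_eq_cube)
    then show ?thesis using assms by simp
  qed
  finally show ?thesis using assms by (simp add: mult_le_cancel_right)
qed

lemma poisson_lower_tail:
  fixes Z :: "'a \<Rightarrow> real"
  assumes mgf: "\<And>l. (\<integral>\<^sup>+x. ennreal (exp (l * Z x)) \<partial>measure_pmf M) \<le> ennreal (exp (\<mu> * (exp l - 1)))"
    and "K \<le> \<mu>" "0 < e" "0 \<le> K"
  shows "measure_pmf.prob M {x. Z x \<le> (1 - e) * K} \<le> exp (- (K * e\<^sup>2 / 4))"
proof -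
  let ?l = "- (e / 2)"
  have "{x. Z x \<le> (1 - e) * K} = {x. ?l * ((1 - e) * K) \<le> ?l * Z x}"
    using assms(3) by auto
  then have "measure_pmf.prob M {x. Z x \<le> (1 - e) * K}
      \<le> exp (- (?l * ((1 - e) * K))) * exp (\<mu> * (exp ?l - 1))"
    using prob_le_exp_moment[OF mgf, of ?l "(1 - e) * K"] by (simp only: exp_ge_zero)
  also have "\<dots> = exp (\<mu> * (exp ?l - 1) - ?l * ((1 - e) * K))"
    by (subst exp_add[symmetric]) (simp only: diff_conv_add_uminus add.commute)
  also have "\<dots> \<le> exp (- (K * e\<^sup>2 / 4))"
  proof -
    have "exp ?l - 1 \<le> - (e / 2) + (e / 2)\<^sup>2" using exp_minus_le[of "e / 2"] assms by simp
    \<comment> \<open>The factor is not positive, so here the lower bound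
      \<open>K \<le> \<mu>\<close> bounds the exponent from above.\<close>
    moreover have "exp ?l - 1 \<le> 0" using assms by simp
    ultimately have "\<mu> * (exp ?l - 1) \<le> K * (- (e / 2) + (e / 2)\<^sup>2)"
      using assms by (intro order_trans[OF mult_right_mono_neg[of K \<mu>] mult_left_mono]) auto
    then show ?thesis by (simp add: field_simps power2_eq_square)
  qed
  finally show ?thesis .
qed

section \<open>One exploration step\<close>

abbreviation bernoulli_family :: "'e set \<Rightarrow> real \<Rightarrow> ('e \<Rightarrow> bool) pmf" where
  "bernoulli_family E p \<equiv> Pi_pmf E False (\<lambda>_. bernoulli_pmf p)"

definition cross_pairs :: "'a set \<Rightarrow> 'a set \<Rightarrow> 'a set set" where
  "cross_pairs X R = (\<lambda>(x, w). {x, w}) ` (X \<times> R)"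

text \<open>The next sphere of breadth-first search, with \<open>U\<close> the part not yet explored
  and \<open>X\<close> the current sphere.\<close>

definition front :: "('a set \<Rightarrow> bool) \<Rightarrow> 'a set \<Rightarrow> 'a set \<Rightarrow> 'a set" where
  "front c U X = {w \<in> U - X. \<exists>x\<in>X. c {x, w}}"

lemma prob_bernoulli_family_all_False:
  assumes "finite E" "0 \<le> p" "p \<le> 1" "S \<subseteq> E"
  shows "measure_pmf.prob (bernoulli_family E p) {c. \<forall>e\<in>S. \<not> c e} = (1 - p) ^ card S"
proof -
  have "{c. \<forall>e\<in>S. \<not> c e} = Pi E (\<lambda>e. if e \<in> S then {False} else UNIV)"
    using assms(4) by (auto simp: Pi_def split: if_splits)
  then have "measure_pmf.prob (bernoulli_family E p) {c. \<forall>e\<in>S. \<not> c e} =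
      (\<Prod>e\<in>E. measure_pmf.prob (bernoulli_pmf p) (if e \<in> S then {False} else UNIV))"
    using assms(1) by (simp add: measure_Pi_pmf_Pi)
  also have "\<dots> = (\<Prod>e\<in>E. if e \<in> S then 1 - p else 1)"
    using assms by (intro prod.cong) (auto simp: measure_pmf_single)
  also have "\<dots> = (1 - p) ^ card S"
    using assms by (simp add: prod.If_cases inf.absorb2)
  finally show ?thesis .
qed

text \<open>Different \<open>w \<in> R\<close> depend on disjoint stars of pairs, as
  \<open>X\<close> and \<open>R\<close> are disjoint, so they are reached independently with
  probability \<open>q\<close>: the count is binomial, and this is its moment generating
  function.\<close>

lemma nn_integral_exp_card_reached:
  fixes p l :: real and X R :: "'a set"
  assumes "finite R" "finite X" "X \<inter> R = {}" "0 \<le> p" "p \<le> 1"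
  defines "q \<equiv> 1 - (1 - p) ^ card X"
  shows "(\<integral>\<^sup>+c. ennreal (exp (l * real (card {w \<in> R. \<exists>x\<in>X. c {x, w}})))
      \<partial>bernoulli_family (cross_pairs X R) p) = ennreal ((1 - q + q * exp l) ^ card R)"
  using assms(1,3)
proof (induction R rule: finite_induct)
  case empty
  then show ?case by (simp add: cross_pairs_def)
next
  case (insert w R)
  have q: "0 \<le> q" "q \<le> 1" using assms by (simp_all add: q_def power_le_one)
  let ?E = "(\<lambda>x. {x, w}) ` X" and ?F = "cross_pairs X R"
  \<comment> \<open>\<open>?N\<close> counts the old vertices reached; \<open>?I\<close> below is
    the factor of the new vertex \<open>w\<close>: 1 if it is missed, \<open>exp l\<close> if it is
    reached.\<close>
  let ?N = "\<lambda>c. real (card {w' \<in> R. \<exists>x\<in>X. c {x, w'}})"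
  let ?I = "\<lambda>c. if \<forall>e\<in>?E. \<not> c e then 1 else exp l"
  have fin: "finite ?E" "finite ?F" using assms(2) insert.hyps by (auto simp: cross_pairs_def)
  have un: "cross_pairs X (insert w R) = ?E \<union> ?F" by (auto simp: cross_pairs_def)
  have notin: "{x, w'} \<notin> ?E" if "x \<in> X" "w' \<in> R" for x w'
    using that insert.hyps insert.prems by (auto simp: doubleton_eq_iff)
  then have disj: "?E \<inter> ?F = {}" by (auto simp: cross_pairs_def)
  have split: "exp (l * real (card {w' \<in> insert w R. \<exists>x\<in>X. if {x, w'} \<in> ?E then f {x, w'} else g {x, w'}}))
      = ?I f * exp (l * ?N g)" for f g :: "'a set \<Rightarrow> bool"
  proof -
    have "{w' \<in> insert w R. \<exists>x\<in>X. if {x, w'} \<in> ?E then f {x, w'} else g {x, w'}} =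
        (if \<forall>e\<in>?E. \<not> f e then {} else {w}) \<union> {w' \<in> R. \<exists>x\<in>X. g {x, w'}}"
      using notin by (auto split: if_splits)
    moreover have "w \<notin> {w' \<in> R. \<exists>x\<in>X. g {x, w'}}" using insert.hyps by simp
    ultimately show ?thesis using insert.hyps
      by (auto simp: ring_distribs exp_add)
  qed
  have block: "(\<integral>\<^sup>+f. ennreal (?I f) \<partial>bernoulli_family ?E p) = ennreal (1 - q + q * exp l)"
  proof -
    let ?T = "{f. \<forall>e\<in>?E. \<not> f e}"
    have "card ?E = card X" using insert.prems by (intro card_image inj_onI) (auto simp: doubleton_eq_iff)
    then have T: "measure_pmf.prob (bernoulli_family ?E p) ?T = 1 - q"
      using prob_bernoulli_family_all_False[OF fin(1) assms(4,5) order_refl] by (simp add: q_def)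
    moreover have "measure_pmf.prob (bernoulli_family ?E p) (- ?T) = q"
      using measure_pmf.prob_compl[of ?T "bernoulli_family ?E p"] T by (simp add: Compl_eq_Diff_UNIV)
    ultimately have em: "emeasure (bernoulli_family ?E p) ?T = ennreal (1 - q)"
      "emeasure (bernoulli_family ?E p) (- ?T) = ennreal q"
      by (simp_all only: measure_pmf.emeasure_eq_measure)
    have "(\<integral>\<^sup>+f. ennreal (?I f) \<partial>bernoulli_family ?E p) =
        (\<integral>\<^sup>+f. indicator ?T f + ennreal (exp l) * indicator (- ?T) f \<partial>bernoulli_family ?E p)"
      by (intro nn_integral_cong) (auto simp: indicator_def)
    also have "\<dots> = ennreal (1 - q) + ennreal (exp l) * ennreal q"
      unfolding em[symmetric]
      by (subst nn_integral_add) (simp_all add: nn_integral_cmult)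
    also have "\<dots> = ennreal (1 - q + q * exp l)"
      using q by (simp add: ennreal_mult[symmetric] ennreal_plus[symmetric] mult.commute del: ennreal_plus)
    finally show ?thesis .
  qed
  have "(\<integral>\<^sup>+c. ennreal (exp (l * real (card {w' \<in> insert w R. \<exists>x\<in>X. c {x, w'}})))
      \<partial>bernoulli_family (?E \<union> ?F) p) =
      (\<integral>\<^sup>+f. \<integral>\<^sup>+g. ennreal (?I f * exp (l * ?N g)) \<partial>bernoulli_family ?F p \<partial>bernoulli_family ?E p)"
    unfolding Pi_pmf_union[OF fin disj] nn_integral_map_pmf nn_integral_pair_pmf'
    by (simp only: prod.case split)
  also have "\<dots> = (\<integral>\<^sup>+f. ennreal (?I f) * ennreal ((1 - q + q * exp l) ^ card R) \<partial>bernoulli_family ?E p)"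
  proof (intro nn_integral_cong)
    fix f
    have "(\<integral>\<^sup>+g. ennreal (?I f * exp (l * ?N g)) \<partial>bernoulli_family ?F p) =
        (\<integral>\<^sup>+g. ennreal (?I f) * ennreal (exp (l * ?N g)) \<partial>bernoulli_family ?F p)"
      by (intro nn_integral_cong) (auto simp: ennreal_mult)
    also have "\<dots> = ennreal (?I f) * (\<integral>\<^sup>+g. ennreal (exp (l * ?N g)) \<partial>bernoulli_family ?F p)"
      by (rule nn_integral_cmult) simp
    also have "(\<integral>\<^sup>+g. ennreal (exp (l * ?N g)) \<partial>bernoulli_family ?F p) = ennreal ((1 - q + q * exp l) ^ card R)"
      using insert by simp
    finally show "(\<integral>\<^sup>+g. ennreal (?I f * exp (l * ?N g)) \<partial>bernoulli_family ?F p) =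
        ennreal (?I f) * ennreal ((1 - q + q * exp l) ^ card R)" .
  qed
  also have "\<dots> = ennreal (1 - q + q * exp l) * ennreal ((1 - q + q * exp l) ^ card R)"
    by (subst nn_integral_multc) (simp_all only: block, simp)
  also have "\<dots> = ennreal ((1 - q + q * exp l) ^ card (insert w R))"
  proof -
    have "0 \<le> 1 - q + q * exp l" using q by simp
    then show ?thesis
      using insert.hyps by (simp only: ennreal_mult[symmetric] zero_le_power card_insert_disjoint power_Suc not_False_eq_True)
  qed
  finally show ?case by (simp only: un)
qed

definition pairs :: "'a set \<Rightarrow> 'a set set" where
  "pairs U = {e. e \<subseteq> U \<and> card e = 2}"

lemma finite_pairs: "finite U \<Longrightarrow> finite (pairs U)"
  by (rule finite_subset[of _ "Pow U"]) (auto simp: pairs_def)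

text \<open>Includes the pairs inside \<open>X\<close>, which do not affect the front, so that
  exactly \<open>pairs (U - X)\<close> remains fresh afterwards.\<close>

definition touching_pairs :: "'a set \<Rightarrow> 'a set \<Rightarrow> 'a set set" where
  "touching_pairs U X = {e \<in> pairs U. e \<inter> X \<noteq> {}}"

text \<open>The front size is binomial, and \<open>1 + y \<le> exp y\<close> bounds its moment
  generating function by that of a Poisson variable with the same mean.\<close>

lemma nn_integral_exp_card_front_le:
  assumes "finite U" "X \<subseteq> U" "0 \<le> p" "p \<le> 1"
  shows "(\<integral>\<^sup>+c. ennreal (exp (l * real (card (front c U X)))) \<partial>bernoulli_family (touching_pairs U X) p)
    \<le> ennreal (exp (real (card (U - X)) * (1 - (1 - p) ^ card X) * (exp l - 1)))"
proof -
  let ?R = "U - X" and ?A = "touching_pairs U X"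
  let ?C = "cross_pairs X ?R"
  define q where "q = 1 - (1 - p) ^ card X"
  have q: "0 \<le> q" "q \<le> 1" using assms by (simp_all add: q_def power_le_one)
  have fA: "finite ?A" using finite_pairs[OF assms(1)] by (simp add: touching_pairs_def)
  have CA: "?C \<subseteq> ?A"
    using assms(2) by (auto simp: cross_pairs_def touching_pairs_def pairs_def card_insert_if)
  have "(\<integral>\<^sup>+c. ennreal (exp (l * real (card {w \<in> ?R. \<exists>x\<in>X. c {x, w}}))) \<partial>bernoulli_family ?C p) =
      ennreal ((1 - q + q * exp l) ^ card ?R)"
    unfolding q_def using assms finite_subset by (intro nn_integral_exp_card_reached) auto
  \<comment> \<open>Pairs inside \<open>X\<close> are forgotten; the default \<open>False\<close>
    put there is never read by the front.\<close>
  also have "bernoulli_family ?C p = map_pmf (\<lambda>f x. if x \<in> ?C then f x else False) (bernoulli_family ?A p)"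
    by (rule Pi_pmf_subset[OF fA CA])
  also have "(\<integral>\<^sup>+c. ennreal (exp (l * real (card {w \<in> ?R. \<exists>x\<in>X. c {x, w}}))) \<partial>\<dots>) =
      (\<integral>\<^sup>+c. ennreal (exp (l * real (card (front c U X)))) \<partial>bernoulli_family ?A p)"
  proof -
    have "{w \<in> ?R. \<exists>x\<in>X. if {x, w} \<in> ?C then c {x, w} else False} = front c U X" for c
      by (auto simp: front_def cross_pairs_def)
    then show ?thesis by (simp only: nn_integral_map_pmf)
  qed
  finally have "(\<integral>\<^sup>+c. ennreal (exp (l * real (card (front c U X)))) \<partial>bernoulli_family ?A p) =
      ennreal ((1 - q + q * exp l) ^ card ?R)" .
  also have "(1 - q + q * exp l) ^ card ?R \<le> exp (q * (exp l - 1)) ^ card ?R"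
  proof (rule power_mono)
    show "1 - q + q * exp l \<le> exp (q * (exp l - 1))"
      using exp_ge_add_one_self[of "q * (exp l - 1)"] by (simp add: algebra_simps)
    show "0 \<le> 1 - q + q * exp l" using q by simp
  qed
  also have "exp (q * (exp l - 1)) ^ card ?R = exp (real (card ?R) * q * (exp l - 1))"
    by (simp add: exp_of_nat_mult mult.assoc)
  finally show ?thesis by (simp add: q_def ennreal_leI)
qed

text \<open>The probability of being reached from \<open>y\<close> vertices is nearly
  \<open>p * y\<close>: Bernoulli's inequality bounds it from above,
  \<open>1 - p \<le> exp (- p)\<close> from below.\<close>

lemma prob_reach_bounds:
  fixes p :: real
  assumes "0 \<le> p" "p \<le> 1"
  shows "1 - (1 - p) ^ y \<le> p * real y" "p * real y * (1 - p * real y) \<le> 1 - (1 - p) ^ y"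
proof -
  show "1 - (1 - p) ^ y \<le> p * real y"
    using Bernoulli_inequality[of "- p" y] assms by (simp add: mult.commute)
  have "(1 - p) ^ y \<le> exp (- p) ^ y"
    using exp_ge_add_one_self[of "- p"] assms by (intro power_mono) auto
  also have "\<dots> = exp (- (p * real y))"
    by (simp add: exp_of_nat_mult[symmetric] mult.commute)
  also have "\<dots> \<le> 1 - p * real y + (p * real y)\<^sup>2"
    using assms by (intro exp_minus_le) simp
  finally show "p * real y * (1 - p * real y) \<le> 1 - (1 - p) ^ y"
    by (simp add: algebra_simps power2_eq_square)
qed

text \<open>With \<open>K = d * card X\<close> the mean front size lies between
  \<open>(1 - e / 2) * K\<close> and \<open>K\<close>: the two terms in \<open>err\<close> measure
  the vertices no longer available and the loss from several edges hitting one vertex. Tail bounds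
  handle the fluctuation.\<close>

lemma prob_front_deviation_le:
  fixes p e d :: real and n :: nat
  assumes U: "finite U" "X \<subseteq> U" "card U \<le> n" and p: "0 \<le> p" "p \<le> 1" and e: "0 < e" "e \<le> 1"
    and d: "d = p * real n" and n: "0 < n"
    and err: "(real n - real (card U) + real (card X)) / real n + p * real (card X) \<le> e / 2"
  shows "measure_pmf.prob (bernoulli_family (touching_pairs U X) p)
     {c. \<not> ((1 - e) * d * real (card X) \<le> real (card (front c U X)) \<and>
            real (card (front c U X)) \<le> (1 + e) * d * real (card X))}
    \<le> 2 * exp (- (d * real (card X) * e\<^sup>2 / 32))"
proof -
  let ?M = "bernoulli_family (touching_pairs U X) p"
  define y where "y = real (card X)"
  define K where "K = d * y"
  define q where "q = 1 - (1 - p) ^ card X"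
  define \<mu> where "\<mu> = real (card (U - X)) * q"
  let ?Z = "\<lambda>c. real (card (front c U X))"
  have mgf: "(\<integral>\<^sup>+c. ennreal (exp (l * ?Z c)) \<partial>?M) \<le> ennreal (exp (\<mu> * (exp l - 1)))" for l
    using nn_integral_exp_card_front_le[OF U(1,2) p, of l] by (simp add: \<mu>_def q_def)
  have q: "q \<le> p * y" "p * y * (1 - p * y) \<le> q" "0 \<le> q"
    using prob_reach_bounds[OF p] p by (simp_all add: q_def y_def power_le_one)
  have y0: "0 \<le> y" and K0: "0 \<le> K" using d p by (simp_all add: y_def K_def)
  have cUX: "real (card (U - X)) = real (card U) - y"
    using U by (simp add: y_def card_Diff_subset card_mono finite_subset of_nat_diff)
  then have UX: "real (card (U - X)) \<le> real n" using U(3) y0 by simp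
  have "\<mu> \<le> real n * (p * y)"
    unfolding \<mu>_def using q UX by (intro mult_mono) auto
  then have \<mu>_le: "\<mu> \<le> K" by (simp add: K_def d mult_ac)
  define b where "b = (real n - real (card U) + y) / real n"
  have b: "0 \<le> b" "b + p * y \<le> e / 2"
    using err U(3) y0 n by (simp_all add: b_def y_def)
  have "real (card (U - X)) = real n * (1 - b)"
    using n by (simp add: cUX b_def field_simps)
  then have "\<mu> = real n * (1 - b) * q" by (simp add: \<mu>_def)
  moreover have "real n * (1 - b) * (p * y * (1 - p * y)) \<le> real n * (1 - b) * q"
    using q b e p y0 by (intro mult_left_mono mult_nonneg_nonneg) (auto intro: order_trans[of _ "b + p * y"])
  moreover have "real n * (1 - b) * (p * y * (1 - p * y)) = K * ((1 - b) * (1 - p * y))"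
    by (simp add: K_def d)
  moreover have "K * (1 - e / 2) \<le> K * ((1 - b) * (1 - p * y))"
  proof (rule mult_left_mono[OF _ K0])
    have "0 \<le> b * (p * y)" using b p y0 by simp
    then show "1 - e / 2 \<le> (1 - b) * (1 - p * y)" using b by (simp add: algebra_simps)
  qed
  ultimately have le_\<mu>: "(1 - e / 2) * K \<le> \<mu>" by (simp add: mult.commute)
  have up: "measure_pmf.prob ?M {c. (1 + e) * K \<le> ?Z c} \<le> exp (- (K * e\<^sup>2 / 4))"
    using poisson_upper_tail[OF mgf \<mu>_le] e K0 by simp
  have low: "measure_pmf.prob ?M {c. ?Z c \<le> (1 - e / 2) * ((1 - e / 2) * K)}
      \<le> exp (- ((1 - e / 2) * K * (e / 2)\<^sup>2 / 4))"
    using poisson_lower_tail[OF mgf le_\<mu>, of "e / 2"] e K0 by simp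
  \<comment> \<open>One half of \<open>e\<close> pays for the bias of the mean, the other for the
    deviation from it.\<close>
  have "(1 - e) * K \<le> (1 - e / 2) * ((1 - e / 2) * K)"
  proof -
    have "(1 - e) * K + (e / 2)\<^sup>2 * K = (1 - e / 2) * ((1 - e / 2) * K)"
      by (simp add: field_simps power2_eq_square)
    then show ?thesis using K0 by (smt (verit) mult_nonneg_nonneg zero_le_power2)
  qed
  then have "{c. \<not> ((1 - e) * K \<le> ?Z c \<and> ?Z c \<le> (1 + e) * K)} \<subseteq>
      {c. (1 + e) * K \<le> ?Z c} \<union> {c. ?Z c \<le> (1 - e / 2) * ((1 - e / 2) * K)}"
    by auto
  then have "measure_pmf.prob ?M {c. \<not> ((1 - e) * K \<le> ?Z c \<and> ?Z c \<le> (1 + e) * K)} \<le>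
      measure_pmf.prob ?M ({c. (1 + e) * K \<le> ?Z c} \<union> {c. ?Z c \<le> (1 - e / 2) * ((1 - e / 2) * K)})"
    by (intro measure_pmf.finite_measure_mono) auto
  also have "\<dots> \<le> exp (- (K * e\<^sup>2 / 4)) + exp (- ((1 - e / 2) * K * (e / 2)\<^sup>2 / 4))"
    by (intro order_trans[OF measure_Un_le] add_mono up low) auto
  also have "\<dots> \<le> exp (- (K * e\<^sup>2 / 32)) + exp (- (K * e\<^sup>2 / 32))"
  proof (intro add_mono)
    show "exp (- (K * e\<^sup>2 / 4)) \<le> exp (- (K * e\<^sup>2 / 32))" using K0 by simp
    \<comment> \<open>Source of the 32: \<open>(e / 2)^2 / 4\<close> is \<open>e^2 / 16\<close>, and
      \<open>1 - e / 2 \<ge> 1 / 2\<close> halves it.\<close>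
    have "K * e\<^sup>2 / 32 = (1 / 2) * (K * (e / 2)\<^sup>2 / 4)" by (simp add: power2_eq_square)
    also have "\<dots> \<le> (1 - e / 2) * (K * (e / 2)\<^sup>2 / 4)"
      using e K0 by (intro mult_right_mono) auto
    finally show "exp (- ((1 - e / 2) * K * (e / 2)\<^sup>2 / 4)) \<le> exp (- (K * e\<^sup>2 / 32))" by (simp add: mult.assoc)
  qed
  finally show ?thesis by (simp add: K_def y_def mult.assoc)
qed

section \<open>Breadth-first exploration\<close>

primrec reach :: "('a set \<Rightarrow> bool) \<Rightarrow> nat \<Rightarrow> 'a set \<Rightarrow> 'a set \<Rightarrow> 'a set" where
  "reach c 0 U X = X"
| "reach c (Suc j) U X = X \<union> reach c j (U - X) (front c U X)"

text \<open>
  \<open>U\<close> is the set of vertices that have not been explored yet, \<open>X \<subseteq> U\<close> the current sphere and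
  \<open>m\<close> its radius; \<open>ok m x y\<close> says that a sphere of size \<open>x\<close> and radius \<open>m\<close> may be followed
  by one of size \<open>y\<close>.
\<close>

primrec growth :: "(nat \<Rightarrow> nat \<Rightarrow> nat \<Rightarrow> bool) \<Rightarrow> ('a set \<Rightarrow> bool) \<Rightarrow> nat \<Rightarrow> nat \<Rightarrow> 'a set \<Rightarrow> 'a set \<Rightarrow> bool" where
  "growth ok c 0 m U X \<longleftrightarrow> True"
| "growth ok c (Suc j) m U X \<longleftrightarrow>
     ok m (card X) (card (front c U X)) \<and> growth ok c j (Suc m) (U - X) (front c U X)"

lemma front_subset: "front c U X \<subseteq> U - X"
  by (auto simp: front_def)

lemma front_cong:
  assumes "X \<subseteq> U" "\<And>x. x \<in> touching_pairs U X \<Longrightarrow> c x = c' x"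
  shows "front c U X = front c' U X"
proof -
  have "c {x, w} = c' {x, w}" if "x \<in> X" "w \<in> U - X" for x w
    using that assms(1) by (intro assms(2)) (auto simp: touching_pairs_def pairs_def card_insert_if)
  then show ?thesis by (auto simp: front_def)
qed

text \<open>Exploring within \<open>U\<close> reads only pairs inside \<open>U\<close>, so given the
  front the later steps depend on \<open>pairs (U - X)\<close> alone.\<close>

lemma growth_cong:
  assumes "X \<subseteq> U" "\<And>x. x \<in> pairs U \<Longrightarrow> c x = c' x"
  shows "growth ok c j m U X = growth ok c' j m U X"
  using assms
proof (induction j arbitrary: m U X)
  case (Suc j)
  have "front c U X = front c' U X"
    using Suc.prems by (intro front_cong) (auto simp: touching_pairs_def)
  moreover have "growth ok c j (Suc m) (U - X) (front c' U X) = growth ok c' j (Suc m) (U - X) (front c' U X)"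
    using Suc.prems(2) by (intro Suc.IH front_subset) (auto simp: pairs_def)
  ultimately show ?case by simp
qed simp

text \<open>Deferred decisions: first reveal the pairs touching \<open>X\<close>, then independently
  those avoiding it. The bind form fits \<open>prob_bind_pmf_le\<close>.\<close>

lemma bernoulli_family_pairs_split:
  assumes "finite U"
  shows "bernoulli_family (pairs U) p = bind_pmf (bernoulli_family (touching_pairs U X) p)
    (\<lambda>f. map_pmf (\<lambda>g x. if x \<in> touching_pairs U X then f x else g x) (bernoulli_family (pairs (U - X)) p))"
proof -
  have "pairs U = touching_pairs U X \<union> pairs (U - X)" "touching_pairs U X \<inter> pairs (U - X) = {}"
    by (auto simp: touching_pairs_def pairs_def)
  moreover have "finite (touching_pairs U X)" "finite (pairs (U - X))"
    using assms by (auto simp: touching_pairs_def finite_pairs)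
  ultimately show ?thesis
    by (simp add: Pi_pmf_union pair_pmf_def map_bind_pmf map_pmf_def[symmetric] bind_assoc_pmf bind_return_pmf
        pmf.map_comp o_def)
qed

section \<open>Balls of the random graph as explored sets\<close>

lemma vertex_pairs_eq: "vertex_pairs n = pairs {1..n}"
  by (simp add: vertex_pairs_def pairs_def)

lemma pverts_graph_of_choice [simp]: "pverts (graph_of_choice n c) = {1..n}"
  by (simp add: graph_of_choice_def)

lemma parcs_graph_of_choice [simp]:
  "(u, v) \<in> parcs (graph_of_choice n c) \<longleftrightarrow> u \<in> {1..n} \<and> v \<in> {1..n} \<and> u \<noteq> v \<and> c {u, v}"
  by (cases "u = v") (auto simp: graph_of_choice_def vertex_pairs_eq pairs_def)

lemma closed_nbhd_graph_of_choice:
  assumes "W \<subseteq> {1..n}" "X \<subseteq> {1..n} - W" "closed_nbhd (graph_of_choice n c) W \<subseteq> W \<union> X"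
  shows "closed_nbhd (graph_of_choice n c) (W \<union> X) = W \<union> X \<union> front c ({1..n} - W) X"
proof (intro equalityI subsetI)
  fix w assume w: "w \<in> closed_nbhd (graph_of_choice n c) (W \<union> X)"
  show "w \<in> W \<union> X \<union> front c ({1..n} - W) X"
  proof (cases "w \<in> closed_nbhd (graph_of_choice n c) W")
    case False
    then show ?thesis using w by (auto simp: closed_nbhd_Un) (auto simp: closed_nbhd_def front_def)
  qed (use assms(3) in auto)
next
  fix w assume "w \<in> W \<union> X \<union> front c ({1..n} - W) X"
  then show "w \<in> closed_nbhd (graph_of_choice n c) (W \<union> X)"
    using assms(1,2) by (fastforce simp: closed_nbhd_def front_def)
qed

text \<open>\<open>W\<close> is the part already processed: no edge leaves it except into the sphere
  \<open>X\<close>, so new vertices come only from \<open>X\<close>. This invariant carries the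
  induction; \<open>W = {}\<close> gives balls around \<open>X\<close>.\<close>

lemma ball_of_eq_reach:
  assumes "W \<subseteq> {1..n}" "X \<subseteq> {1..n} - W" "closed_nbhd (graph_of_choice n c) W \<subseteq> W \<union> X"
  shows "ball_of (graph_of_choice n c) j (W \<union> X) = W \<union> reach c j ({1..n} - W) X"
  using assms
proof (induction j arbitrary: W X)
  case (Suc j)
  let ?Y = "front c ({1..n} - W) X"
  have eq: "closed_nbhd (graph_of_choice n c) (W \<union> X) = W \<union> X \<union> ?Y"
    by (rule closed_nbhd_graph_of_choice[OF Suc.prems])
  have "ball_of (graph_of_choice n c) (Suc j) (W \<union> X) = ball_of (graph_of_choice n c) j (W \<union> X \<union> ?Y)"
    by (simp add: ball_of_Suc eq)
  also have "\<dots> = W \<union> X \<union> reach c j ({1..n} - (W \<union> X)) ?Y"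
  proof (rule Suc.IH)
    show "W \<union> X \<subseteq> {1..n}" using Suc.prems by auto
    show "?Y \<subseteq> {1..n} - (W \<union> X)" using front_subset[of c "{1..n} - W" X] by auto
    show "closed_nbhd (graph_of_choice n c) (W \<union> X) \<subseteq> W \<union> X \<union> ?Y" by (simp add: eq)
  qed
  also have "{1..n} - (W \<union> X) = {1..n} - W - X" by auto
  finally show ?case by (simp add: Un_assoc)
qed simp

section \<open>Products and sums of relative errors\<close>

lemma prod_one_minus_ge:
  fixes e :: "nat \<Rightarrow> real"
  assumes "\<And>l. l < m \<Longrightarrow> 0 \<le> e l" "\<And>l. l < m \<Longrightarrow> e l \<le> 1"
  shows "1 - (\<Sum>l<m. e l) \<le> (\<Prod>l<m. 1 - e l) \<and> (\<Prod>l<m. 1 - e l) \<le> 1"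
  using assms
proof (induction m)
  case (Suc m)
  let ?P = "\<Prod>l<m. 1 - e l"
  have IH: "1 - (\<Sum>l<m. e l) \<le> ?P" "?P \<le> 1" using Suc by auto
  have e: "0 \<le> e m" "e m \<le> 1" using Suc.prems by auto
  \<comment> \<open>Uses the bound of the product by 1, which is carried along in the induction for
    this purpose.\<close>
  have "?P * e m \<le> 1 * e m" using IH e by (intro mult_right_mono) auto
  moreover have "0 \<le> ?P" using Suc.prems by (intro prod_nonneg) auto
  then have "0 \<le> ?P * e m" using e by simp
  ultimately show ?case using IH by (simp add: algebra_simps)
qed simp

text \<open>Compare with \<open>exp\<close> of the sum; on the unit interval
  \<open>exp s \<le> 1 + s + s^2 \<le> 1 + 2 * s\<close>.\<close>

lemma prod_one_plus_le:
  fixes e :: "nat \<Rightarrow> real"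
  assumes "\<And>l. l < m \<Longrightarrow> 0 \<le> e l" "(\<Sum>l<m. e l) \<le> 1"
  shows "(\<Prod>l<m. 1 + e l) \<le> 1 + 2 * (\<Sum>l<m. e l)"
proof -
  let ?s = "\<Sum>l<m. e l"
  have s: "0 \<le> ?s" using assms by (intro sum_nonneg) auto
  have "(\<Prod>l<m. 1 + e l) \<le> (\<Prod>l<m. exp (e l))"
    using assms by (intro prod_mono) (auto simp: add_nonneg_nonneg exp_ge_add_one_self)
  also have "\<dots> = exp ?s" by (simp add: exp_sum)
  also have "\<dots> \<le> 1 + ?s + ?s\<^sup>2" using s assms(2) by (intro exp_bound)
  also have "?s\<^sup>2 \<le> ?s" using s assms(2) by (simp add: power2_eq_square mult_left_le)
  finally show ?thesis by simp
qed

lemma sum_powers_le: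
  fixes d :: real
  assumes "2 \<le> d"
  shows "(\<Sum>l\<le>i. d ^ l) \<le> d ^ i * (1 + 2 / d)"
proof (induction i)
  case (Suc i)
  have d2: "2 * d ^ i \<le> d ^ Suc i" using assms by simp
  have "(\<Sum>l\<le>Suc i. d ^ l) \<le> d ^ i * (1 + 2 / d) + d ^ Suc i" using Suc by simp
  \<comment> \<open>The crude bound suffices, since \<open>2 * d ^ i\<close> is \<open>2 / d\<close>
    times the new leading term.\<close>
  also have "d ^ i * (1 + 2 / d) \<le> d ^ i * 2" using assms by (intro mult_left_mono) auto
  also have "d ^ i * 2 + d ^ Suc i = d ^ Suc i * (1 + 2 / d)" using assms by (simp add: field_simps)
  finally show ?case by simp
qed (use assms in simp)

text \<open>\<open>e m\<close> is the relative error allowed from radius \<open>m\<close> to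
  \<open>m + 1\<close>. \<open>e_bias\<close> covers the drop of the mean through exhausted
  vertices, \<open>e_dev\<close> makes each step fail with probability at most
  \<open>2 / n^4\<close>, and \<open>e_sum\<close> keeps sphere sizes within a factor 2 of their
  ideal value.\<close>

locale exploration =
  fixes n i :: nat and p d :: real and e :: "nat \<Rightarrow> real"
  assumes p: "0 \<le> p" "p \<le> 1" and n: "0 < n" and d: "d = p * real n" and d_ge: "4 \<le> d"
    and e_pos: "\<And>m. m < i \<Longrightarrow> 0 < e m" and e_sum: "(\<Sum>m<i. e m) \<le> 1 / 2"
    and e_bias: "\<And>m. m < i \<Longrightarrow> 24 * d ^ Suc m / real n \<le> e m"
    and e_dev: "\<And>m. m < i \<Longrightarrow> 256 * ln (real n) \<le> (e m)\<^sup>2 * d ^ Suc m"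
begin

definition ok :: "nat \<Rightarrow> nat \<Rightarrow> nat \<Rightarrow> bool" where
  "ok m x y \<longleftrightarrow> (1 - e m) * d * real x \<le> real y \<and> real y \<le> (1 + e m) * d * real x"

text \<open>Together with \<open>hi\<close>, the envelopes for the size of the sphere of radius
  \<open>m\<close> around \<open>x\<close> centres.\<close>

definition lo :: "real \<Rightarrow> nat \<Rightarrow> real" where
  "lo x m = x * d ^ m * (\<Prod>l<m. 1 - e l)"

definition hi :: "real \<Rightarrow> nat \<Rightarrow> real" where
  "hi x m = x * d ^ m * (\<Prod>l<m. 1 + e l)"

lemma sum_e_le: "m \<le> i \<Longrightarrow> (\<Sum>l<m. e l) \<le> (\<Sum>l<i. e l)"
  by (intro sum_mono2) (auto intro: less_imp_le[OF e_pos])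

lemma e_le:
  assumes "m < i"
  shows "e m \<le> 1 / 2"
proof -
  have "e m \<le> (\<Sum>m<i. e m)"
    using assms by (intro member_le_sum) (auto intro: less_imp_le[OF e_pos])
  then show ?thesis using e_sum by simp
qed

lemma lo_ge:
  assumes "m \<le> i" "0 \<le> x"
  shows "x * d ^ m * (1 - (\<Sum>l<i. e l)) \<le> lo x m"
proof -
  have "1 - (\<Sum>l<m. e l) \<le> (\<Prod>l<m. 1 - e l)"
  proof (rule conjunct1[OF prod_one_minus_ge])
    fix l assume "l < m"
    then show "0 \<le> e l" "e l \<le> 1" using e_pos[of l] e_le[of l] assms(1) by auto
  qed
  then show ?thesis unfolding lo_def using sum_e_le[OF assms(1)] assms(2) d_ge
    by (intro mult_left_mono) auto
qed

lemma hi_le: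
  assumes "m \<le> i" "0 \<le> x"
  shows "hi x m \<le> x * d ^ m * (1 + 2 * (\<Sum>l<i. e l))"
proof -
  have "(\<Prod>l<m. 1 + e l) \<le> 1 + 2 * (\<Sum>l<m. e l)"
    using sum_e_le[OF assms(1)] e_sum assms(1) by (intro prod_one_plus_le) (auto intro: less_imp_le[OF e_pos])
  then show ?thesis unfolding hi_def using sum_e_le[OF assms(1)] assms(2) d_ge
    by (intro mult_left_mono) auto
qed

text \<open>The explored part and the current sphere have at most
  \<open>4 * d ^ m \<le> d ^ Suc m\<close> vertices each, and
  \<open>p * card X \<le> 4 * d ^ Suc m / n\<close>, so the bias stays below \<open>e m / 2\<close>.
  By \<open>card X \<ge> d ^ m / 2\<close> the exponent is at least
  \<open>256 / 64 * ln n\<close>.\<close>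

lemma prob_not_ok_le:
  assumes U: "X \<subseteq> U" "U \<subseteq> {1..n}" "real n - real (card U) \<le> 4 * d ^ m" and m: "m < i"
    and X: "d ^ m / 2 \<le> real (card X)" "real (card X) \<le> 4 * d ^ m"
  shows "measure_pmf.prob (bernoulli_family (touching_pairs U X) p)
    {c. \<not> ok m (card X) (card (front c U X))} \<le> 2 / real n ^ 4"
proof -
  have fU: "finite U" "card U \<le> n"
    using U finite_subset card_mono[of "{1..n}" U] by auto
  have dm: "4 * d ^ m \<le> d ^ Suc m" using d_ge by simp
  have "(real n - real (card U) + real (card X)) / real n \<le> (2 * d ^ Suc m) / real n"
    using U X dm n by (intro divide_right_mono) auto
  moreover have "p * real (card X) \<le> (4 * d ^ Suc m) / real n"
    using mult_left_mono[OF X(2) p(1)] n by (simp add: d field_simps)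
  ultimately have "(real n - real (card U) + real (card X)) / real n + p * real (card X) \<le> 
      (2 * d ^ Suc m) / real n + (4 * d ^ Suc m) / real n" by linarith
  also have "\<dots> \<le> (12 * d ^ Suc m) / real n"
    using d_ge n by (simp add: field_simps)
  also have "\<dots> \<le> e m / 2" using e_bias[OF m] by simp
  finally have "measure_pmf.prob (bernoulli_family (touching_pairs U X) p)
      {c. \<not> ok m (card X) (card (front c U X))} \<le> 2 * exp (- (d * real (card X) * (e m)\<^sup>2 / 32))"
    unfolding ok_def using e_le[OF m] by (intro prob_front_deviation_le[OF fU(1) U(1) fU(2) p e_pos[OF m] _ d n]) auto
  also have "exp (- (d * real (card X) * (e m)\<^sup>2 / 32)) \<le> exp (- (4 * ln (real n)))"
  proof -
    have "256 * ln (real n) \<le> (e m)\<^sup>2 * d * (2 * (d ^ m / 2))" using e_dev[OF m] by (simp add: mult_ac)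
    also have "\<dots> \<le> (e m)\<^sup>2 * d * (2 * real (card X))"
      using X(1) d_ge by (intro mult_left_mono) auto
    finally show ?thesis by (simp add: mult_ac)
  qed
  also have "exp (- (4 * ln (real n))) = 1 / real n ^ 4"
    using n exp_of_nat_mult[of 4 "ln (real n)"] by (simp add: exp_minus inverse_eq_divide)
  finally show ?thesis by simp
qed

text \<open>Condition on the pairs touching \<open>X\<close>: either this step fails, or the front
  again lies between the envelopes and the remaining steps use only fresh pairs inside
  \<open>U - X\<close>.\<close>

lemma prob_not_growth_le:
  assumes "x \<in> {1, 2}" "m + j \<le> i" "X \<subseteq> U" "U \<subseteq> {1..n}" "real n - real (card U) \<le> 4 * d ^ m"
    and "lo x m \<le> real (card X)" "real (card X) \<le> hi x m"
  shows "measure_pmf.prob (bernoulli_family (pairs U) p) {c. \<not> growth ok c j m U X} \<le> real j * (2 / real n ^ 4)"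
  using assms(2-)
proof (induction j arbitrary: m U X)
  case 0
  then show ?case by simp
next
  case (Suc j)
  let ?T = "touching_pairs U X"
  let ?h = "\<lambda>f g x. if x \<in> ?T then f x else (g x :: bool)"
  have m: "m < i" using Suc.prems(1) by simp
  have fU: "finite U" using Suc.prems(3) finite_subset by blast
  have x: "1 \<le> x" "x \<le> 2" using assms(1) by auto
  have s: "0 \<le> (\<Sum>l<i. e l)" by (intro sum_nonneg) (auto intro: less_imp_le[OF e_pos])
  have d0: "0 \<le> d ^ m" using d_ge by simp
  have "1 * d ^ m * (1 / 2) \<le> x * d ^ m * (1 - (\<Sum>l<i. e l))"
    using x e_sum d0 by (intro mult_mono) auto
  then have X_ge: "d ^ m / 2 \<le> real (card X)"
    using lo_ge[of m x] x m Suc.prems(5) by simp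
  have "x * d ^ m * (1 + 2 * (\<Sum>l<i. e l)) \<le> 2 * d ^ m * 2"
    using x e_sum d0 s by (intro mult_mono) auto
  then have X_le: "real (card X) \<le> 4 * d ^ m"
    using hi_le[of m x] x m Suc.prems(6) by simp
  have "measure_pmf.prob (bernoulli_family (pairs U) p) {c. \<not> growth ok c (Suc j) m U X} \<le>
      measure_pmf.prob (bernoulli_family ?T p) {c. \<not> ok m (card X) (card (front c U X))} +
      real j * (2 / real n ^ 4)"
    unfolding bernoulli_family_pairs_split[OF fU, of p X]
  proof (rule prob_bind_pmf_le)
    fix f assume "f \<notin> {c. \<not> ok m (card X) (card (front c U X))}"
    then have ok: "ok m (card X) (card (front f U X))" by simp
    let ?Y = "front f U X"
    have fr: "front (?h f g) U X = ?Y" for g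
      using Suc.prems(2) by (intro front_cong) auto
    have gr: "growth ok (?h f g) j (Suc m) (U - X) ?Y = growth ok g j (Suc m) (U - X) ?Y" for g
      by (intro growth_cong front_subset) (auto simp: touching_pairs_def pairs_def)
    have "measure_pmf.prob (map_pmf (?h f) (bernoulli_family (pairs (U - X)) p))
        {c. \<not> growth ok c (Suc j) m U X} =
      measure_pmf.prob (bernoulli_family (pairs (U - X)) p) {g. \<not> growth ok g j (Suc m) (U - X) ?Y}"
      by (simp only: measure_map_pmf vimage_def mem_Collect_eq growth.simps fr gr ok simp_thms)
    also have "\<dots> \<le> real j * (2 / real n ^ 4)"
    proof (rule Suc.IH)
      show "Suc m + j \<le> i" using Suc.prems(1) by simp
      show "?Y \<subseteq> U - X" by (rule front_subset)
      show "U - X \<subseteq> {1..n}" using Suc.prems(3) by auto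
      have "real (card (U - X)) = real (card U) - real (card X)"
        using Suc.prems(2) fU by (simp add: card_Diff_subset card_mono finite_subset of_nat_diff)
      \<comment> \<open>The explored part grows to at most \<open>8 * d ^ m\<close>, below
        \<open>4 * d ^ Suc m\<close> as \<open>d \<ge> 4\<close>.\<close>
      then show "real n - real (card (U - X)) \<le> 4 * d ^ Suc m"
        using Suc.prems(4) X_le mult_right_mono[OF d_ge d0] by simp
      have "lo x (Suc m) = (1 - e m) * d * lo x m" by (simp add: lo_def mult_ac)
      also have "\<dots> \<le> (1 - e m) * d * real (card X)"
        using Suc.prems(5) e_le[OF m] d_ge by (intro mult_left_mono) auto
      finally show "lo x (Suc m) \<le> real (card ?Y)" using ok by (simp add: ok_def)
      have "(1 + e m) * d * real (card X) \<le> (1 + e m) * d * hi x m"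
        using Suc.prems(6) e_pos[OF m] d_ge by (intro mult_left_mono) auto
      also have "\<dots> = hi x (Suc m)" by (simp add: hi_def mult_ac)
      finally show "real (card ?Y) \<le> hi x (Suc m)" using ok by (simp add: ok_def)
    qed
    finally show "measure_pmf.prob (map_pmf (?h f) (bernoulli_family (pairs (U - X)) p))
        {c. \<not> growth ok c (Suc j) m U X} \<le> real j * (2 / real n ^ 4)" .
  qed simp
  also have "measure_pmf.prob (bernoulli_family ?T p) {c. \<not> ok m (card X) (card (front c U X))} \<le> 2 / real n ^ 4"
    by (rule prob_not_ok_le[OF Suc.prems(2,3,4) m X_ge X_le])
  finally show ?case by (simp add: ring_distribs add_divide_distrib)
qed

text \<open>The case \<open>u = v\<close> is included, so single balls and, for
  \<open>i > 0\<close>, degrees are controlled as well.\<close>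

definition typical :: "(nat set \<Rightarrow> bool) \<Rightarrow> bool" where
  "typical c \<longleftrightarrow> (\<forall>u\<in>{1..n}. \<forall>v\<in>{1..n}. growth ok c i 0 {1..n} {u, v})"

text \<open>Union bound over \<open>n^2\<close> choices of centres, each failing with probability at
  most \<open>2 * i / n^4\<close>.\<close>

lemma prob_not_typical_le:
  "measure_pmf.prob (bernoulli_family (pairs {1..n}) p) {c. \<not> typical c} \<le> 2 * real i / (real n)\<^sup>2"
proof -
  let ?M = "bernoulli_family (pairs {1..n}) p"
  let ?B = "\<lambda>(u, v). {c. \<not> growth ok c i 0 {1..n} {u, v}}"
  have "{c. \<not> typical c} = (\<Union>uv\<in>{1..n} \<times> {1..n}. ?B uv)"
    by (auto simp: typical_def)
  then have "measure_pmf.prob ?M {c. \<not> typical c} \<le> (\<Sum>uv\<in>{1..n} \<times> {1..n}. measure_pmf.prob ?M (?B uv))"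
    using measure_pmf.finite_measure_subadditive_finite[of "{1..n} \<times> {1..n}" ?B ?M] by simp
  also have "\<dots> \<le> (\<Sum>uv\<in>{1..n} \<times> {1..n}. real i * (2 / real n ^ 4))"
  proof (rule sum_mono)
    fix uv assume "uv \<in> {1..n} \<times> {1..n}"
    then obtain u v where uv: "uv = (u, v)" "u \<in> {1..n}" "v \<in> {1..n}" by auto
    have "measure_pmf.prob ?M {c. \<not> growth ok c i 0 {1..n} {u, v}} \<le> real i * (2 / real n ^ 4)"
      by (rule prob_not_growth_le[of "real (card {u, v})"])
        (use uv in \<open>auto simp: lo_def hi_def card_insert_if\<close>)
    then show "measure_pmf.prob ?M (?B uv) \<le> real i * (2 / real n ^ 4)" by (simp add: uv)
  qed
  also have "\<dots> = 2 * real i / (real n)\<^sup>2"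
    using n by (simp add: card_cartesian_product power2_eq_square power4_eq_xxxx)
  finally show ?thesis .
qed

text \<open>The lower bound counts only the outermost sphere; the upper bound adds up all of
  them.\<close>

lemma card_reach_bounds:
  assumes "growth ok c j m U X" "finite U" "X \<subseteq> U" "m + j \<le> i" "lo x m \<le> real (card X)" "real (card X) \<le> hi x m"
  shows "finite (reach c j U X) \<and> lo x (m + j) \<le> real (card (reach c j U X)) \<and>
    real (card (reach c j U X)) \<le> (\<Sum>l\<in>{m..m + j}. hi x l)"
  using assms
proof (induction j arbitrary: m U X)
  case 0
  then show ?case using finite_subset by auto
next
  case (Suc j)
  let ?Y = "front c U X"
  have m: "m < i" using Suc.prems(4) by simp
  have ok: "ok m (card X) (card ?Y)" using Suc.prems(1) by simp
  have fX: "finite X" using Suc.prems finite_subset by blast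
  have "lo x (Suc m) = (1 - e m) * d * lo x m" by (simp add: lo_def mult_ac)
  also have "\<dots> \<le> (1 - e m) * d * real (card X)"
    using Suc.prems(5) e_le[OF m] d_ge by (intro mult_left_mono) auto
  finally have lo: "lo x (Suc m) \<le> real (card ?Y)" using ok by (simp add: ok_def)
  have "(1 + e m) * d * real (card X) \<le> (1 + e m) * d * hi x m"
    using Suc.prems(6) e_pos[OF m] d_ge by (intro mult_left_mono) auto
  also have "\<dots> = hi x (Suc m)" by (simp add: hi_def mult_ac)
  finally have hi: "real (card ?Y) \<le> hi x (Suc m)" using ok by (simp add: ok_def)
  have IH: "finite (reach c j (U - X) ?Y)" "lo x (Suc m + j) \<le> real (card (reach c j (U - X) ?Y))"
    "real (card (reach c j (U - X) ?Y)) \<le> (\<Sum>l\<in>{Suc m..Suc m + j}. hi x l)"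
    using Suc.IH[of "Suc m" "U - X" ?Y] Suc.prems front_subset[of c U X] lo hi by auto
  have "card (reach c j (U - X) ?Y) \<le> card (reach c (Suc j) U X)"
    using IH(1) fX by (intro card_mono) auto
  moreover have "card (reach c (Suc j) U X) \<le> card X + card (reach c j (U - X) ?Y)"
    by (simp add: card_Un_le)
  moreover have "(\<Sum>l\<in>{m..m + Suc j}. hi x l) = hi x m + (\<Sum>l\<in>{Suc m..Suc m + j}. hi x l)"
    by (simp add: sum.atLeast_Suc_atMost)
  ultimately show ?case using IH fX Suc.prems(6) by auto
qed

section \<open>Typical graphs: resolving vertices and degrees\<close>

context
  fixes c assumes c_typical: "typical c"
begin

lemma ball_of_bounds:
  assumes "u \<in> {1..n}" "v \<in> {1..n}"
  shows "lo (real (card {u, v})) i \<le> real (card (ball_of (graph_of_choice n c) i {u, v}))"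
    "real (card (ball_of (graph_of_choice n c) i {u, v})) \<le> (\<Sum>l\<le>i. hi (real (card {u, v})) l)"
proof -
  have "ball_of (graph_of_choice n c) i {u, v} = reach c i {1..n} {u, v}"
    using ball_of_eq_reach[of "{}" n "{u, v}" c i] assms by (simp add: closed_nbhd_def)
  moreover have "growth ok c i 0 {1..n} {u, v}" using c_typical assms by (simp add: typical_def)
  ultimately show "lo (real (card {u, v})) i \<le> real (card (ball_of (graph_of_choice n c) i {u, v}))"
    "real (card (ball_of (graph_of_choice n c) i {u, v})) \<le> (\<Sum>l\<le>i. hi (real (card {u, v})) l)"
    using card_reach_bounds[of c i 0 "{1..n}" "{u, v}" "real (card {u, v})"] assms
    by (simp_all add: lo_def hi_def atMost_atLeast0)
qed

lemma card_ball_le: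
  assumes "u \<in> {1..n}"
  shows "real (card (ball_of (graph_of_choice n c) i {u})) \<le> d ^ i * (1 + 2 / d) * (1 + 2 * (\<Sum>l<i. e l))"
proof -
  have "real (card (ball_of (graph_of_choice n c) i {u})) \<le> (\<Sum>l\<le>i. hi 1 l)"
    using ball_of_bounds(2)[OF assms assms] by simp
  also have "\<dots> \<le> (\<Sum>l\<le>i. d ^ l * (1 + 2 * (\<Sum>l<i. e l)))"
    using hi_le[of _ 1] by (intro sum_mono) auto
  also have "\<dots> = (\<Sum>l\<le>i. d ^ l) * (1 + 2 * (\<Sum>l<i. e l))" by (simp add: sum_distrib_right)
  also have "\<dots> \<le> d ^ i * (1 + 2 / d) * (1 + 2 * (\<Sum>l<i. e l))"
    using sum_powers_le[of d i] d_ge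
    by (intro mult_right_mono add_nonneg_nonneg mult_nonneg_nonneg sum_nonneg) (auto intro: less_imp_le[OF e_pos])
  finally show ?thesis .
qed

text \<open>The joint ball has about \<open>2 * d ^ i\<close> vertices and each single ball about
  \<open>d ^ i\<close>, so the symmetric difference has about \<open>2 * d ^ i\<close>.\<close>

lemma card_resolving_typical:
  assumes "u \<in> {1..n}" "v \<in> {1..n}" "u \<noteq> v"
  shows "2 * d ^ i * (1 - (5 * (\<Sum>l<i. e l) + 2 / d)) \<le>
    real (card {s \<in> {1..n}. graph_dist (graph_of_choice n c) u s \<noteq> graph_dist (graph_of_choice n c) v s})"
    (is "_ \<le> real (card ?R)")
proof -
  let ?G = "graph_of_choice n c" and ?s = "\<Sum>l<i. e l"
  interpret G: pair_graph ?G by (rule pair_graph_graph_of_choice)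
  have "2 * card (ball_of ?G i {u, v}) \<le> card ?R + card (ball_of ?G i {u}) + card (ball_of ?G i {v})"
    using G.card_resolving_ge[of u v i] assms by simp
  then have "2 * real (card (ball_of ?G i {u, v})) \<le>
      real (card ?R) + real (card (ball_of ?G i {u})) + real (card (ball_of ?G i {v}))"
    by linarith
  moreover have "2 * d ^ i * (1 - ?s) \<le> real (card (ball_of ?G i {u, v}))"
    using ball_of_bounds(1)[OF assms(1,2)] lo_ge[of i 2] assms(3) by simp
  ultimately have "4 * (d ^ i * (1 - ?s)) - 2 * (d ^ i * (1 + 2 / d) * (1 + 2 * ?s)) \<le> real (card ?R)"
    using card_ball_le[OF assms(1)] card_ball_le[OF assms(2)] by linarith
  moreover have "2 * d ^ i * (1 - (5 * ?s + 2 / d)) \<le>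
      4 * (d ^ i * (1 - ?s)) - 2 * (d ^ i * (1 + 2 / d) * (1 + 2 * ?s))"
  proof -
    have "0 \<le> ?s" by (intro sum_nonneg) (auto intro: less_imp_le[OF e_pos])
    \<comment> \<open>Expanding gives \<open>1 - 4 * ?s - 2 / d - (4 / d) * ?s\<close>; as
      \<open>d \<ge> 4\<close> the last term costs one more \<open>?s\<close>, hence the 5.\<close>
    then have "(4 / d) * ?s \<le> 1 * ?s" using d_ge by (intro mult_right_mono) auto
    then have "1 - (5 * ?s + 2 / d) \<le> 2 * (1 - ?s) - (1 + 2 / d) * (1 + 2 * ?s)"
      by (simp add: algebra_simps)
    then have "2 * d ^ i * (1 - (5 * ?s + 2 / d)) \<le> 2 * d ^ i * (2 * (1 - ?s) - (1 + 2 / d) * (1 + 2 * ?s))"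
      using d_ge by (intro mult_left_mono) auto
    then show ?thesis by (simp add: algebra_simps)
  qed
  ultimately show ?thesis by linarith
qed

lemma card_closed_nbhd_typical:
  assumes "u \<in> {1..n}" "0 < i"
  shows "real (card (closed_nbhd (graph_of_choice n c) {u})) \<le> 3 * d"
proof -
  have eq: "closed_nbhd (graph_of_choice n c) {u} = {u} \<union> front c {1..n} {u}"
    using closed_nbhd_graph_of_choice[of "{}" n "{u}" c] assms(1) by (simp add: closed_nbhd_def)
  obtain j where "i = Suc j" using assms(2) gr0_implies_Suc by blast
  \<comment> \<open>Equal centres turn the first exploration step into a bound on the degree of
    \<open>u\<close>.\<close>
  moreover have "growth ok c i 0 {1..n} {u, u}" using c_typical assms(1) unfolding typical_def by blast
  ultimately have "real (card (front c {1..n} {u})) \<le> (1 + e 0) * d" by (simp add: ok_def)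
  also have "\<dots> \<le> (3 / 2) * d" using e_le[of 0] assms(2) d_ge by (intro mult_right_mono) auto
  finally have "real (card (front c {1..n} {u})) \<le> (3 / 2) * d" .
  moreover have "card (closed_nbhd (graph_of_choice n c) {u}) \<le> 1 + card (front c {1..n} {u})"
    unfolding eq using card_Un_le[of "{u}" "front c {1..n} {u}"] by simp
  ultimately show ?thesis using d_ge by linarith
qed

end

end

section \<open>Connectivity\<close>

text \<open>If some vertex were unreachable from \<open>u\<close>, the set reachable from
  \<open>u\<close> would define a cut crossed by no edge.\<close>

lemma connected_graph_of_choice:
  assumes n: "0 < n"
    and cut: "\<And>S. S \<subseteq> {1..n} \<Longrightarrow> S \<noteq> {} \<Longrightarrow> S \<noteq> {1..n} \<Longrightarrow> \<exists>x\<in>cross_pairs S ({1..n} - S). c x"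
  shows "Digraph_Component.connected (with_proj (graph_of_choice n c))"
proof -
  let ?G = "graph_of_choice n c"
  interpret G: pair_graph ?G by (rule pair_graph_graph_of_choice)
  have reach: "u \<rightarrow>\<^sup>*\<^bsub>with_proj ?G\<^esub> v" if u: "u \<in> {1..n}" and v: "v \<in> {1..n}" for u v
  proof -
    define S where "S = {v \<in> {1..n}. u \<rightarrow>\<^sup>*\<^bsub>with_proj ?G\<^esub> v}"
    have uS: "u \<in> S" using u by (simp add: S_def G.reachable_refl)
    have "S = {1..n}"
    proof (rule ccontr)
      assume "S \<noteq> {1..n}"
      moreover have "S \<subseteq> {1..n}" "S \<noteq> {}" using uS by (auto simp: S_def)
      ultimately obtain x where "x \<in> cross_pairs S ({1..n} - S)" "c x"
        using cut[of S] by blast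
      then obtain a b where ab: "a \<in> S" "b \<in> {1..n} - S" "c {a, b}" by (auto simp: cross_pairs_def)
      then have "(a, b) \<in> parcs ?G" by (auto simp: S_def)
      moreover have "u \<rightarrow>\<^sup>*\<^bsub>with_proj ?G\<^esub> a" using ab(1) by (simp add: S_def)
      ultimately have "u \<rightarrow>\<^sup>*\<^bsub>with_proj ?G\<^esub> b"
        using G.reachable_adj_trans by simp
      then show False using ab(2) by (auto simp: S_def)
    qed
    then have "v \<in> S" using v by (simp only:)
    then show ?thesis by (simp add: S_def)
  qed
  have "u \<rightarrow>\<^sup>*\<^bsub>with_proj (mk_symmetric (with_proj ?G))\<^esub> v" if "u \<in> {1..n}" "v \<in> {1..n}" for u v
    by (rule G.reachable_mk_symmetricI[OF reach[OF that]])
  then show ?thesis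
    using n by (simp add: Digraph_Component.connected_def strongly_connected_def)
qed

lemma sum_power_card_Pow:
  fixes z :: "'b :: comm_semiring_1"
  assumes "finite A"
  shows "(\<Sum>S\<in>Pow A. z ^ card S) = (1 + z) ^ card A"
  using prod_add[OF assms, of "\<lambda>_. z" "\<lambda>_. 1"] by (simp add: add.commute)

text \<open>Union bound over the cuts, indexed by a side \<open>S\<close> with at most half of the
  vertices. At least \<open>n / 2\<close> vertices lie opposite, so no edge crosses with probability
  at most \<open>z ^ card S\<close>; the binomial theorem sums this over all nonempty
  \<open>S\<close> to \<open>(1 + z) ^ n - 1\<close>.\<close>

lemma prob_not_connected_le:
  fixes p :: real
  assumes n: "0 < n" and p: "0 \<le> p" "p \<le> 1"
  shows "measure_pmf.prob (bernoulli_family (pairs {1..n}) p)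
      {c. \<not> Digraph_Component.connected (with_proj (graph_of_choice n c))}
    \<le> exp (real n * exp (- (p * real n / 2))) - 1"
proof -
  let ?V = "{1..n}"
  let ?M = "bernoulli_family (pairs ?V) p"
  let ?B = "\<lambda>S. {c. \<forall>x\<in>cross_pairs S (?V - S). \<not> c x}"
  define F where "F = {S. S \<subseteq> ?V \<and> S \<noteq> {} \<and> 2 * card S \<le> n}"
  define z where "z = exp (- (p * real n / 2))"
  have fF: "finite F" by (rule finite_subset[of _ "Pow ?V"]) (auto simp: F_def)
  have sub: "{c. \<not> Digraph_Component.connected (with_proj (graph_of_choice n c))} \<subseteq> (\<Union>S\<in>F. ?B S)"
  proof
    fix c assume "c \<in> {c. \<not> Digraph_Component.connected (with_proj (graph_of_choice n c))}"
    then obtain S where S: "S \<subseteq> ?V" "S \<noteq> {}" "S \<noteq> ?V" "c \<in> ?B S"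
      using connected_graph_of_choice[OF n, of c] by auto
    show "c \<in> (\<Union>S\<in>F. ?B S)"
    proof (cases "2 * card S \<le> n")
      case True
      then show ?thesis using S by (auto simp: F_def)
    next
      case False
      have "card (?V - S) = n - card S" using S by (simp add: card_Diff_subset finite_subset)
      \<comment> \<open>A side that is too large is replaced by its complement, which defines the
        same cut.\<close>
      then have "?V - S \<in> F" using False S by (auto simp: F_def)
      moreover have "?V - (?V - S) = S" using S by auto
      moreover have "cross_pairs (?V - S) S = cross_pairs S (?V - S)"
        by (auto simp: cross_pairs_def insert_commute image_iff)
      ultimately show ?thesis using S(4) by (intro UN_I[of "?V - S"]) auto
    qed
  qed
  have cut: "measure_pmf.prob ?M (?B S) \<le> z ^ card S" if "S \<in> F" for S
  proof -
    have S: "S \<subseteq> ?V" "2 * card S \<le> n" using that by (auto simp: F_def)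
    then have fS: "finite S" using finite_subset by blast
    have "inj_on (\<lambda>(x, w). {x, w}) (S \<times> (?V - S))"
      by (auto simp: inj_on_def doubleton_eq_iff)
    then have card: "card (cross_pairs S (?V - S)) = card S * (n - card S)"
      using S fS by (simp add: cross_pairs_def card_image card_cartesian_product card_Diff_subset)
    have "cross_pairs S (?V - S) \<subseteq> pairs ?V"
      using S by (auto simp: cross_pairs_def pairs_def card_insert_if)
    then have "measure_pmf.prob ?M (?B S) = (1 - p) ^ (card S * (n - card S))"
      using prob_bernoulli_family_all_False[OF finite_pairs p, of ?V "cross_pairs S (?V - S)"] card by simp
    also have "\<dots> = ((1 - p) ^ (n - card S)) ^ card S"
      by (metis mult.commute power_mult)
    also have "\<dots> \<le> z ^ card S"
    proof (rule power_mono)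
      have "(1 - p) ^ (n - card S) \<le> exp (- p) ^ (n - card S)"
        using p exp_ge_add_one_self[of "- p"] by (intro power_mono) auto
      also have "\<dots> = exp (- (p * real (n - card S)))"
        by (simp add: exp_of_nat_mult[symmetric] mult.commute)
      also have "\<dots> \<le> z"
      proof -
        have "real n / 2 \<le> real (n - card S)" using S(2) by linarith
        then have "p * (real n / 2) \<le> p * real (n - card S)" using p by (intro mult_left_mono) auto
        then show ?thesis by (simp add: z_def)
      qed
      finally show "(1 - p) ^ (n - card S) \<le> z" .
    qed (use p in simp)
    finally show ?thesis .
  qed
  have "measure_pmf.prob ?M {c. \<not> Digraph_Component.connected (with_proj (graph_of_choice n c))}
      \<le> measure_pmf.prob ?M (\<Union>S\<in>F. ?B S)"
    using sub by (intro measure_pmf.finite_measure_mono) auto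
  also have "\<dots> \<le> (\<Sum>S\<in>F. measure_pmf.prob ?M (?B S))"
    by (intro measure_pmf.finite_measure_subadditive_finite fF) auto
  also have "\<dots> \<le> (\<Sum>S\<in>F. z ^ card S)" by (intro sum_mono cut)
  also have "\<dots> \<le> (\<Sum>S\<in>Pow ?V - {{}}. z ^ card S)"
    by (intro sum_mono2) (auto simp: F_def z_def)
  also have "\<dots> = (1 + z) ^ n - 1"
    using sum_power_card_Pow[of ?V z] by (simp add: sum_diff1)
  also have "(1 + z) ^ n \<le> exp z ^ n"
    by (intro power_mono exp_ge_add_one_self) (simp add: z_def)
  also have "exp z ^ n = exp (real n * z)" by (simp add: exp_of_nat_mult)
  finally show ?thesis by (simp add: z_def)
qed

section \<open>The bound on the localization number\<close>

text \<open>\<open>k\<close> is \<open>B\<close> rounded down and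
  \<open>B * (D / n) = 2 * ln d + 4 * ln (ln n)\<close>, so the unresolved fraction is at most
  \<open>exp 1 / (d^2 * ln n ^ 4)\<close>. Its \<open>d^2\<close> cancels that of the squared degree
  bound \<open>(3 * d)^2\<close>.\<close>

lemma (in exploration) localization_number_typical_le:
  assumes c: "typical c" and i: "0 < i"
    and \<delta>: "5 * (\<Sum>m<i. e m) + 2 / d \<le> \<delta>" "\<delta> < 1" and di: "2 * d ^ i \<le> real n" and ln: "4 \<le> ln (real n)"
    and B: "B = 1 / (1 - \<delta>) * (ln d + 2 * ln (ln (real n))) * (real n / d ^ i)" "B \<le> real n"
  shows "real (localization_number (graph_of_choice n c)) \<le> B"
proof -
  let ?G = "graph_of_choice n c"
  interpret G: pair_graph ?G by (rule pair_graph_graph_of_choice)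
  define D where "D = 2 * d ^ i * (1 - \<delta>)"
  define k where "k = nat \<lfloor>B\<rfloor>"
  have d0: "0 < d" "0 < d ^ i" using d_ge by auto
  have "0 \<le> (\<Sum>m<i. e m)" by (intro sum_nonneg) (auto intro: less_imp_le[OF e_pos])
  then have \<delta>0: "0 \<le> \<delta>" using \<delta>(1) d0 by (smt (verit) divide_nonneg_pos)
  have "0 \<le> ln d + 2 * ln (ln (real n))" using d_ge ln by simp
  then have "0 \<le> B" using \<delta>(2) d0 by (simp add: B(1))
  then have k: "real k \<le> B" "B - 1 \<le> real k" unfolding k_def by linarith+
  have D: "D / real n \<le> 1" "0 \<le> D"
  proof -
    have "D \<le> 2 * d ^ i * 1" unfolding D_def using \<delta>0 d0 by (intro mult_left_mono) auto
    then show "D / real n \<le> 1" using di n by simp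
    show "0 \<le> D" using \<delta>(2) d0 by (simp add: D_def)
  qed
  have BD: "B * (D / real n) = 2 * (ln d + 2 * ln (ln (real n)))"
    using \<delta>(2) d0 n by (simp add: B(1) D_def) (simp add: field_simps)
  define x where "x = D / real n"
  have x: "0 \<le> x" "x \<le> 1" "B * x = 2 * ln d + 4 * ln (ln (real n))"
    using D n BD by (simp_all add: x_def)
  \<comment> \<open>Rounding costs at most \<open>x \<le> 1\<close> in the exponent, hence the
    factor \<open>exp 1\<close>.\<close>
  have "(B - 1) * x \<le> real k * x" using k x by (intro mult_right_mono) auto
  then have "2 * ln d + 4 * ln (ln (real n)) - 1 \<le> real k * x"
    using x by (simp add: left_diff_distrib)
  then have kD: "2 * ln d + 4 * ln (ln (real n)) - 1 \<le> real k * (D / real n)" by (simp only: x_def)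
  have "(1 - D / real n) ^ k \<le> exp (- (D / real n)) ^ k"
    using exp_ge_add_one_self[of "- (D / real n)"] D by (intro power_mono) auto
  also have "\<dots> = exp (- (real k * (D / real n)))" by (simp add: exp_of_nat_mult[symmetric])
  also have "\<dots> \<le> exp (1 - 2 * ln d - 4 * ln (ln (real n)))" using kD by simp
  also have "\<dots> = exp 1 / (d\<^sup>2 * ln (real n) ^ 4)"
  proof -
    have "exp (2 * ln d) = d\<^sup>2" using exp_of_nat_mult[of 2 "ln d"] d0 by simp
    moreover have "exp (4 * ln (ln (real n))) = ln (real n) ^ 4"
      using exp_of_nat_mult[of 4 "ln (ln (real n))"] ln by simp
    ultimately show ?thesis by (simp add: exp_diff)
  qed
  finally have "4 * (3 * d)\<^sup>2 * (1 - D / real n) ^ k \<le> 4 * (3 * d)\<^sup>2 * (exp 1 / (d\<^sup>2 * ln (real n) ^ 4))"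
    by (intro mult_left_mono) auto
  also have "\<dots> = 36 * exp 1 / ln (real n) ^ 4" using d0 by (simp add: field_simps)
  \<comment> \<open>The term \<open>2 * ln (ln n)\<close> in \<open>B\<close> has produced the
    fourth power of \<open>ln n\<close>, which absorbs the constant:
    \<open>36 * 3 \<le> 4 ^ 4\<close>.\<close>
  also have "\<dots> \<le> 1"
  proof -
    have "(4 :: real) ^ 4 \<le> ln (real n) ^ 4" using ln by (intro power_mono) auto
    moreover have "36 * exp 1 \<le> (4 :: real) ^ 4" using exp_le by simp
    ultimately have "36 * exp 1 \<le> ln (real n) ^ 4" by linarith
    then show ?thesis using ln by (simp add: divide_le_eq)
  qed
  finally have small: "4 * (3 * d)\<^sup>2 * (1 - D / real (card (pverts ?G))) ^ k \<le> 1" by simp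
  have "cops_can_win ?G k"
  proof (rule cops_can_win_if_resolving[OF _ _ _ _ _ _ small])
    show "k \<le> card (pverts ?G)" using k(1) B(2) by simp
    show "D \<le> real (card (pverts ?G))" using D(1) n by (simp add: divide_le_eq)
    show "real (card (closed_nbhd ?G {v})) \<le> 3 * d" if "v \<in> pverts ?G" for v
      using card_closed_nbhd_typical[OF c _ i] that by simp
    fix u v assume uv: "u \<in> pverts ?G" "v \<in> pverts ?G" "u \<noteq> v"
    have "D \<le> 2 * d ^ i * (1 - (5 * (\<Sum>m<i. e m) + 2 / d))"
      unfolding D_def using \<delta>(1) d0 by (intro mult_left_mono) auto
    then show "D \<le> real (card {s \<in> pverts ?G. graph_dist ?G u s \<noteq> graph_dist ?G v s})"
      using card_resolving_typical[OF c, of u v] uv by simp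
  qed (use n in auto)
  then have "localization_number ?G \<le> k"
    unfolding localization_number_def by (rule Least_le)
  then show ?thesis using k(1) by linarith
qed

section \<open>Choice of the errors and the asymptotic statement\<close>

lemma sum_half_powers_le:
  fixes x :: real
  assumes "0 \<le> x"
  shows "(\<Sum>m<i. x / 2 ^ m) \<le> 2 * x"
proof -
  have "(\<Sum>m<i. x / 2 ^ m) = 2 * x - 2 * x / 2 ^ i"
    by (induction i) (auto simp: field_simps)
  then show ?thesis using assms by simp
qed

text \<open>
  The error allowed at radius \<open>m\<close> has one term for the random fluctuations of the sphere sizes,
  which decreases with \<open>m\<close>, and one for the exhaustion of the vertex set, which increases with
  \<open>m\<close>. Both are dominated by geometric series, so the total error does not depend on the number
  of steps.
\<close>

lemma exploration_errors:
  fixes p d :: real and n i :: nat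
  defines "\<eta> \<equiv> sqrt (256 * ln (real n) / d)"
  defines "e \<equiv> \<lambda>m. \<eta> / 2 ^ m + 24 * d ^ Suc m / real n"
  assumes p: "0 \<le> p" "p \<le> 1" and d: "d = p * real n" and d_ge: "4 \<le> d" and n: "1 < n"
    and small: "2 * \<eta> + 48 * (d ^ i / real n) \<le> 1 / 2"
  shows "exploration n i p d e" "(\<Sum>m<i. e m) \<le> 2 * \<eta> + 48 * (d ^ i / real n)"
proof -
  have \<eta>: "0 < \<eta>" "\<eta>\<^sup>2 * d = 256 * ln (real n)" using d_ge n by (simp_all add: \<eta>_def)
  \<comment> \<open>The last term dominates the geometric sum; the factor 2 turns 24 into
    48.\<close>
  have powers: "(\<Sum>m<i. d ^ Suc m) \<le> 2 * d ^ i"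
  proof (induction i)
    case (Suc i)
    have "2 * d ^ i \<le> d ^ Suc i" using d_ge by simp
    then show ?case using Suc by simp
  qed simp
  have "(\<Sum>m<i. e m) = (\<Sum>m<i. \<eta> / 2 ^ m) + 24 / real n * (\<Sum>m<i. d ^ Suc m)"
    by (simp add: e_def sum.distrib sum_distrib_left)
  also have "\<dots> \<le> 2 * \<eta> + 24 / real n * (2 * d ^ i)"
    using \<eta>(1) n powers by (intro add_mono sum_half_powers_le mult_left_mono) auto
  finally show le: "(\<Sum>m<i. e m) \<le> 2 * \<eta> + 48 * (d ^ i / real n)" by simp
  show "exploration n i p d e"
  proof
    show "(\<Sum>m<i. e m) \<le> 1 / 2" using le small by linarith
    fix m
    have d0: "0 \<le> 24 * d ^ Suc m / real n" using d_ge by simp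
    then show "0 < e m" using \<eta>(1) unfolding e_def by (intro add_pos_nonneg) auto
    show "24 * d ^ Suc m / real n \<le> e m" using \<eta>(1) by (simp add: e_def)
    \<comment> \<open>At \<open>m = 0\<close> this is the choice of \<open>\<eta>\<close>;
      afterwards halving the error costs a factor 4 per step in its square, while
      \<open>d ^ m\<close> gains at least as much.\<close>
    have "256 * ln (real n) * 1 \<le> 256 * ln (real n) * (d / 4) ^ m"
      using n d_ge by (intro mult_left_mono one_le_power) auto
    also have "\<dots> = (\<eta> / 2 ^ m)\<^sup>2 * d ^ Suc m"
    proof -
      have "((2 :: real) ^ m)\<^sup>2 = (2\<^sup>2) ^ m" by (simp only: power_mult[symmetric] mult.commute)
      then have *: "(\<eta> / 2 ^ m)\<^sup>2 = \<eta>\<^sup>2 / 4 ^ m" by (simp add: power_divide)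
      show ?thesis unfolding \<eta>(2)[symmetric] * by (simp add: power_divide)
    qed
    also have "\<dots> \<le> (e m)\<^sup>2 * d ^ Suc m"
      using \<eta>(1) d0 d_ge by (intro mult_right_mono power_mono) (auto simp: e_def)
    finally show "256 * ln (real n) \<le> (e m)\<^sup>2 * d ^ Suc m" by simp
  qed (use p d d_ge n in auto)
qed

lemma prob_binomial_random_graph:
  "measure_pmf.prob (binomial_random_graph n p) {G. P G} =
    measure_pmf.prob (bernoulli_family (pairs {1..n}) p) {c. P (graph_of_choice n c)}"
  by (simp add: binomial_random_graph_def vertex_pairs_eq vimage_def)

theorem theorem6p1:
  fixes p d :: "nat \<Rightarrow> real" and i :: "nat \<Rightarrow> nat"
  assumes "\<And>n. 0 \<le> p n \<and> p n \<le> 1"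
    and "\<And>n. d n = p n * real n"
    and "(\<lambda>n. ln (real n)) \<in> o(d)"
    and "d \<in> o(\<lambda>n. real n)"
    and "(\<lambda>n. d n ^ i n) \<in> o(\<lambda>n. real n)"
    and "\<And>j :: nat \<Rightarrow> nat. (\<lambda>n. d n ^ j n) \<in> o(\<lambda>n. real n) \<Longrightarrow> eventually (\<lambda>n. j n \<le> i n) sequentially"
    and "filterlim (\<lambda>n. d n ^ (i n + 1) / real n - 2 * ln (real n)) at_top sequentially"
  shows "\<exists>\<epsilon> :: nat \<Rightarrow> real. \<epsilon> \<longlonglongrightarrow> 0 \<and>
    aas p (\<lambda>n G. Digraph_Component.connected (with_proj G) \<and>
      real (localization_number G)
        \<le> (1 + \<epsilon> n) * (ln (d n) + 2 * ln (ln (real n))) * (real n / d n ^ i n))"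
proof -
  define \<eta> where "\<eta> = (\<lambda>n. sqrt (256 * ln (real n) / d n))"
  define r where "r = (\<lambda>n. d n ^ i n / real n)"
  define s where "s = (\<lambda>n. 2 * \<eta> n + 48 * r n)"
  define \<delta> where "\<delta> = (\<lambda>n. 5 * s n + 2 / d n)"
  \<comment> \<open>Chosen so that \<open>1 + \<epsilon> n\<close> is the factor
    \<open>1 / (1 - \<delta> n)\<close> in \<open>localization_number_typical_le\<close>.\<close>
  define \<epsilon> where "\<epsilon> = (\<lambda>n. 1 / (1 - \<delta> n) - 1)"
  define B where "B = (\<lambda>n. (1 + \<epsilon> n) * (ln (d n) + 2 * ln (ln (real n))) * (real n / d n ^ i n))"
  let ?con = "\<lambda>G. Digraph_Component.connected (with_proj G)"
  have p: "0 \<le> p n" "p n \<le> 1" for n using assms(1) by auto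
  have d0: "0 \<le> d n" for n using p(1) by (simp add: assms(2))
  \<comment> \<open>As \<open>d \<in> o(n)\<close>, the constant exponent 1 is admissible, so
    maximality of \<open>i\<close> gives \<open>i n \<ge> 1\<close>.\<close>
  have i_pos: "eventually (\<lambda>n. 0 < i n) sequentially"
    using assms(6)[of "\<lambda>_. 1"] assms(4) by (auto elim: eventually_mono)
  have ln_top: "filterlim (\<lambda>n. ln (real n)) at_top sequentially" by real_asymp
  have d_ln: "eventually (\<lambda>n. C * ln (real n) \<le> d n) sequentially" if "0 < C" for C :: real
  proof -
    have "eventually (\<lambda>n. norm (ln (real n)) \<le> 1 / C * norm (d n)) sequentially"
      using that by (intro landau_o.smallD[OF assms(3)]) simp
    then show ?thesis
    proof eventually_elim
      case (elim n)
      have "ln (real n) \<le> norm (ln (real n))" by simp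
      also have "\<dots> \<le> 1 / C * d n" using elim d0[of n] by simp
      finally show ?case using that by (simp add: field_simps)
    qed
  qed
  have d_top: "filterlim d at_top sequentially"
    using filterlim_at_top_mono[OF ln_top d_ln[of 1, simplified]] .
  have "(\<lambda>n. ln (real n) / d n) \<longlonglongrightarrow> 0"
    using smalloD_tendsto[OF assms(3)] .
  then have "(\<lambda>n. sqrt (256 * (ln (real n) / d n))) \<longlonglongrightarrow> sqrt (256 * 0)"
    by (intro tendsto_intros)
  then have \<eta>_lim: "\<eta> \<longlonglongrightarrow> 0" by (simp add: \<eta>_def)
  have r_lim: "r \<longlonglongrightarrow> 0" unfolding r_def by (rule smalloD_tendsto[OF assms(5)])
  have "(\<lambda>n. 2 * \<eta> n + 48 * r n) \<longlonglongrightarrow> 2 * 0 + 48 * 0"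
    by (intro tendsto_intros \<eta>_lim r_lim)
  then have s_lim: "s \<longlonglongrightarrow> 0" by (simp add: s_def)
  have "(\<lambda>n. 2 / d n) \<longlonglongrightarrow> 0"
    by (rule real_tendsto_divide_at_top[OF tendsto_const d_top])
  then have "(\<lambda>n. 5 * s n + 2 / d n) \<longlonglongrightarrow> 5 * 0 + 0"
    by (intro tendsto_intros s_lim)
  then have \<delta>_lim: "\<delta> \<longlonglongrightarrow> 0" by (simp add: \<delta>_def)
  then have "(\<lambda>n. 1 / (1 - \<delta> n) - 1) \<longlonglongrightarrow> 1 / (1 - 0) - 1"
    by (intro tendsto_intros) auto
  then have \<epsilon>_lim: "\<epsilon> \<longlonglongrightarrow> 0" by (simp add: \<epsilon>_def)
  have ln_over: "eventually (\<lambda>n. ln (d n) \<le> d n / 4) sequentially"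
  proof -
    have "eventually (\<lambda>x :: real. ln x \<le> x / 4) at_top" by real_asymp
    then show ?thesis using d_top by (rule eventually_compose_filterlim)
  qed
  have lnln: "eventually (\<lambda>n. ln (ln (real n)) \<le> ln (real n)) sequentially" by real_asymp
  have "eventually (\<lambda>n. s n < 1 / 2) sequentially" "eventually (\<lambda>n. \<delta> n < 1 / 2) sequentially"
    "eventually (\<lambda>n. r n < 1 / 2) sequentially"
    by (rule order_tendstoD(2)[OF s_lim] order_tendstoD(2)[OF \<delta>_lim] order_tendstoD(2)[OF r_lim], simp)+
  moreover have "eventually (\<lambda>n. 4 \<le> ln (real n)) sequentially" by real_asymp
  \<comment> \<open>With \<open>4 \<le> ln n\<close> this gives \<open>d n \<ge> 64\<close>; it also
    serves the bound \<open>B n \<le> n\<close> and the connectivity estimate.\<close>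
  moreover have "eventually (\<lambda>n. 16 * ln (real n) \<le> d n) sequentially" by (rule d_ln) simp
  ultimately have ev: "eventually (\<lambda>n. 0 < i n \<and> 4 \<le> ln (real n) \<and> 16 * ln (real n) \<le> d n \<and>
      ln (d n) \<le> d n / 4 \<and> ln (ln (real n)) \<le> ln (real n) \<and>
      s n \<le> 1 / 2 \<and> \<delta> n \<le> 1 / 2 \<and> r n \<le> 1 / 2) sequentially"
    using i_pos ln_over lnln by eventually_elim simp
  let ?prob = "\<lambda>n. measure_pmf.prob (binomial_random_graph n (p n)) {G. ?con G \<and> real (localization_number G) \<le> B n}"
  have lower: "eventually (\<lambda>n. 1 - (2 / real n + (exp (1 / real n) - 1)) \<le> ?prob n) sequentially"
    using ev
  proof eventually_elim
    case (elim n)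
    let ?M = "bernoulli_family (pairs {1..n}) (p n)"
    define e where "e = (\<lambda>m. \<eta> n / 2 ^ m + 24 * d n ^ Suc m / real n)"
    have n1: "1 < n" "0 < real n"
    proof -
      show "1 < n" using elim by (cases "n \<le> 1") (auto simp: le_Suc_eq)
      then show "0 < real n" by simp
    qed
    have d4: "4 \<le> d n" using elim by linarith
    have s: "2 * sqrt (256 * ln (real n) / d n) + 48 * (d n ^ i n / real n) \<le> 1 / 2"
      using elim by (simp add: s_def \<eta>_def r_def)
    interpret exploration n "i n" "p n" "d n" e
      unfolding e_def \<eta>_def using exploration_errors(1)[OF p assms(2) d4 n1(1) s] .
    have e_sum_le: "(\<Sum>m<i n. e m) \<le> s n"
      using exploration_errors(2)[OF p assms(2) d4 n1(1) s] by (simp add: e_def s_def \<eta>_def r_def)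
    have di: "2 * d n ^ i n \<le> real n" using elim n1 by (simp add: r_def divide_le_eq)
    \<comment> \<open>The number of sensors may not exceed the number of vertices.\<close>
    have B_le: "B n \<le> real n"
    proof -
      have "1 + \<epsilon> n \<le> 2" using elim by (simp add: \<epsilon>_def divide_le_eq)
      moreover have "ln (d n) + 2 * ln (ln (real n)) \<le> d n / 2" using elim by linarith
      moreover have "0 \<le> ln (d n) + 2 * ln (ln (real n))" using elim d4 by simp
      ultimately have "(1 + \<epsilon> n) * (ln (d n) + 2 * ln (ln (real n))) \<le> 2 * (d n / 2)"
        by (intro mult_mono) auto
      also have "\<dots> \<le> d n ^ i n" using elim d4 by (simp add: self_le_power)
      finally have "B n \<le> d n ^ i n * (real n / d n ^ i n)"
        unfolding B_def using d4 by (intro mult_right_mono) auto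
      then show ?thesis using d4 by simp
    qed
    have good: "?con (graph_of_choice n c) \<and> real (localization_number (graph_of_choice n c)) \<le> B n"
      if "typical c" "?con (graph_of_choice n c)" for c
    proof (intro conjI that(2) localization_number_typical_le[OF that(1), of "\<delta> n"])
      show "5 * (\<Sum>m<i n. e m) + 2 / d n \<le> \<delta> n" using e_sum_le by (simp add: \<delta>_def)
      show "B n = 1 / (1 - \<delta> n) * (ln (d n) + 2 * ln (ln (real n))) * (real n / d n ^ i n)"
        by (simp add: B_def \<epsilon>_def)
    qed (use elim di B_le in auto)
    \<comment> \<open>From \<open>2 ^ i n \<le> d n ^ i n \<le> n\<close>; it keeps the failure
      probability over all steps of order \<open>1 / n\<close>.\<close>
    have "real (i n) \<le> real n"
    proof -
      have "i n < 2 ^ i n" by (rule less_exp)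
      then have "real (i n) \<le> 2 ^ i n" by (metis less_imp_le of_nat_le_iff of_nat_numeral of_nat_power)
      also have "\<dots> \<le> d n ^ i n" using d4 by (intro power_mono) auto
      also have "\<dots> \<le> real n" using di d4 by (smt (verit) zero_le_power)
      finally show ?thesis .
    qed
    then have "2 * real (i n) / (real n)\<^sup>2 \<le> 2 * real n / (real n)\<^sup>2" by (intro divide_right_mono) auto
    also have "\<dots> = 2 / real n" by (simp add: power2_eq_square)
    finally have typical_le: "measure_pmf.prob ?M {c. \<not> typical c} \<le> 2 / real n"
      using prob_not_typical_le by (rule order_trans[rotated])
    have "real n * exp (- (p n * real n / 2)) \<le> 1 / real n"
    proof -
      \<comment> \<open>Since \<open>d n \<ge> 16 * ln n\<close>, the exponent
        \<open>d n / 2\<close> is at least \<open>2 * ln n\<close>, so disconnection has probability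
        at most \<open>exp (1 / n) - 1\<close>.\<close>
      have "exp (- (p n * real n / 2)) \<le> exp (- (2 * ln (real n)))"
        using elim by (simp add: assms(2)[symmetric])
      also have "\<dots> = 1 / (real n)\<^sup>2"
        using n1 exp_of_nat_mult[of 2 "ln (real n)"] by (simp add: exp_minus inverse_eq_divide)
      finally have "real n * exp (- (p n * real n / 2)) \<le> real n * (1 / (real n)\<^sup>2)"
        by (intro mult_left_mono) auto
      then show ?thesis using n1 by (simp add: power2_eq_square)
    qed
    then have "exp (real n * exp (- (p n * real n / 2))) - 1 \<le> exp (1 / real n) - 1" by simp
    moreover have "measure_pmf.prob ?M {c. \<not> ?con (graph_of_choice n c)}
        \<le> exp (real n * exp (- (p n * real n / 2))) - 1"
      by (rule prob_not_connected_le) (use n1 p in simp_all)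
    ultimately have con: "measure_pmf.prob ?M {c. \<not> ?con (graph_of_choice n c)} \<le> exp (1 / real n) - 1"
      by linarith
    let ?P = "{c. ?con (graph_of_choice n c) \<and> real (localization_number (graph_of_choice n c)) \<le> B n}"
    have "1 - measure_pmf.prob ?M ?P = measure_pmf.prob ?M (- ?P)"
      using measure_pmf.prob_compl[of ?P ?M] by (simp add: Compl_eq_Diff_UNIV)
    also have "\<dots> \<le> measure_pmf.prob ?M ({c. \<not> typical c} \<union> {c. \<not> ?con (graph_of_choice n c)})"
      using good by (intro measure_pmf.finite_measure_mono) auto
    also have "\<dots> \<le> measure_pmf.prob ?M {c. \<not> typical c} + measure_pmf.prob ?M {c. \<not> ?con (graph_of_choice n c)}"
      by (rule measure_Un_le) auto
    finally show ?case
      using typical_le con by (simp add: prob_binomial_random_graph)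
  qed
  have "?prob \<longlonglongrightarrow> 1"
  proof (rule tendsto_sandwich[OF lower])
    show "eventually (\<lambda>n. ?prob n \<le> 1) sequentially" by simp
    show "(\<lambda>n. 1 - (2 / real n + (exp (1 / real n) - 1))) \<longlonglongrightarrow> 1" by real_asymp
  qed simp
  then show ?thesis
    using \<epsilon>_lim unfolding aas_def B_def by blast
qed

end
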